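(* Let $\Omega\subset\mathbb{R}^N$ be a bounded domain with Lipschitz boundary, let $s\in(0,1)$ and $p>N/s$, and let $\alpha\in L^\infty(\Omega)$ with $\operatorname{ess\,inf}_{x\in\Omega}\alpha(x)>0$. Let $f:\mathbb{R}\to\mathbb{R}$ be continuous and nonnegative with $f(0)=0$, and set $F(t):=\int_0^t f(\zeta)\,d\zeta$. Fix $L\in\{0^+,\infty\}$ and suppose that $$\liminf_{t\to L}\frac{F(t)}{t^p}=0\quad\text{and}\quad\limsup_{t\to L}\frac{F(t)}{t^p}=\infty.$$ Then for every $\lambda>0$ the problem $$(-\Delta)^s_p u=\lambda\alpha(x)f(u)\ \text{ in }\Omega,\qquad u=0\ \text{ in }\mathbb{R}^N\setminus\Omega,$$ admits a sequence $(u_{\lambda,j})_j$ of nonnegative weak solutions in $X_0^{s,p}(\Omega)$. Moreover, $\lim_{j\to\infty}\|u_{\lambda,j}\|=\infty$ if $L=\infty$, and $\lim_{j\to\infty}\|u_{\lambda,j}\|=\lim_{j\to\infty}\|u_{\lambda,j}\|_\infty=0$ if $L=0^+$.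
   Context: The space is $X_0^{s,p}(\Omega):=\{u\in W^{s,p}(\mathbb{R}^N): u=0 \text{ a.e. in }\mathbb{R}^N\setminus\Omega\}$, where $W^{s,p}(\mathbb{R}^N)$ is the set of $u\in L^p(\mathbb{R}^N)$ with $\iint_{\mathbb{R}^N\times\mathbb{R}^N}\frac{|u(x)-u(y)|^p}{|x-y|^{N+ps}}\,dx\,dy<\infty$. It is endowed with the norm $$\|u\|:=\left(\iint_{\mathbb{R}^N\times\mathbb{R}^N}\frac{|u(x)-u(y)|^p}{|x-y|^{N+ps}}\,dx\,dy\right)^{1/p}.$$ Since $p>N/s$, $X_0^{s,p}(\Omega)$ embeds continuously into $C^0(\bar\Omega)$; $\|\cdot\|_\infty$ denotes the sup norm. A weak solution of the problem is a function $u\in X_0^{s,p}(\Omega)$ such that, for every $\varphi\in X_0^{s,p}(\Omega)$, $$\iint_{\mathbb{R}^N\times\mathbb{R}^N}\frac{|u(x)-u(y)|^{p-2}(u(x)-u(y))(\varphi(x)-\varphi(y))}{|x-y|^{N+ps}}\,dx\,dy=\lambda\int_\Omega\alpha(x)f(u(x))\varphi(x)\,dx.$$ The limit $t\to L$ means $t\to 0^+$ if $L=0^+$ and $t\to+\infty$ if $L=\infty$. *)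

theory Defs
  imports "HOL-Analysis.Analysis" "HOL-Probability.Essential_Supremum"
begin

text \<open>
  The space \<open>\<real>\<^sup>N\<close> is an arbitrary type \<open>'a::euclidean_space\<close> with \<open>N = DIM('a)\<close>.
  Elements of Lebesgue and Sobolev spaces are represented by Lebesgue measurable functions, and
  two functions that agree almost everywhere represent the same element. Double integrals over
  \<open>\<real>\<^sup>N \<times> \<real>\<^sup>N\<close> are integrals with respect to Lebesgue measure on the product type.
\<close>

subsection \<open>Lipschitz domains\<close>

text \<open>
  Near each boundary point the set is, in suitable orthonormal coordinates, the strict epigraph of
  a Lipschitz function of the first \<open>N - 1\<close> coordinates. The vector \<open>e\<close> is the direction of the last
  coordinate, and the hyperplane orthogonal to \<open>e\<close> carries the remaining ones.
\<close>

definition lipschitz_boundary :: "'a::euclidean_space set \<Rightarrow> bool" where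
  "lipschitz_boundary \<Omega> \<longleftrightarrow>
     (\<forall>x\<in>frontier \<Omega>. \<exists>r>0. \<exists>e g C. norm e = 1 \<and> C-lipschitz_on {v. v \<bullet> e = 0} g \<and>
        \<Omega> \<inter> ball x r = {y \<in> ball x r. g (y - (y \<bullet> e) *\<^sub>R e) < y \<bullet> e})"

definition bounded_lipschitz_domain :: "'a::euclidean_space set \<Rightarrow> bool" where
  "bounded_lipschitz_domain \<Omega> \<longleftrightarrow>
     open \<Omega> \<and> connected \<Omega> \<and> \<Omega> \<noteq> {} \<and> bounded \<Omega> \<and> lipschitz_boundary \<Omega>"

subsection \<open>Essentially bounded functions\<close>

definition L_infty :: "'a measure \<Rightarrow> ('a \<Rightarrow> real) set" where
  "L_infty M = {f \<in> borel_measurable M. esssup M (\<lambda>x. ereal \<bar>f x\<bar>) < \<infinity>}"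

definition essinf :: "'a measure \<Rightarrow> ('a \<Rightarrow> real) \<Rightarrow> ereal" where
  "essinf M f = Sup {c. AE x in M. c \<le> ereal (f x)}"

subsection \<open>Fractional Sobolev spaces\<close>

text \<open>
  On the diagonal the quotients below evaluate to \<open>0\<close>, since \<open>0 powr a = 0\<close> and \<open>a / 0 = 0\<close>;
  the diagonal is a null set.
\<close>

definition gagliardo_integrand ::
    "real \<Rightarrow> real \<Rightarrow> ('a::euclidean_space \<Rightarrow> real) \<Rightarrow> 'a \<times> 'a \<Rightarrow> real" where
  "gagliardo_integrand s p u =
     (\<lambda>(x, y). \<bar>u x - u y\<bar> powr p / norm (x - y) powr (real DIM('a) + p * s))"

definition frac_sobolev :: "real \<Rightarrow> real \<Rightarrow> ('a::euclidean_space \<Rightarrow> real) set" where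
  "frac_sobolev s p =
     {u \<in> borel_measurable lebesgue.
        integrable lebesgue (\<lambda>x. \<bar>u x\<bar> powr p) \<and> integrable lebesgue (gagliardo_integrand s p u)}"

definition X0 :: "real \<Rightarrow> real \<Rightarrow> 'a::euclidean_space set \<Rightarrow> ('a \<Rightarrow> real) set" where
  "X0 s p \<Omega> = {u \<in> frac_sobolev s p. AE x in lebesgue. x \<notin> \<Omega> \<longrightarrow> u x = 0}"

definition X0_norm :: "real \<Rightarrow> real \<Rightarrow> ('a::euclidean_space \<Rightarrow> real) \<Rightarrow> real" where
  "X0_norm s p u = (LINT z|lebesgue. gagliardo_integrand s p u z) powr (1 / p)"

text \<open>To be applied to representatives that are continuous on the compact set \<open>closure \<Omega>\<close>.\<close>

definition sup_norm :: "'a::euclidean_space set \<Rightarrow> ('a \<Rightarrow> real) \<Rightarrow> real" where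
  "sup_norm \<Omega> u = (SUP x\<in>closure \<Omega>. \<bar>u x\<bar>)"

subsection \<open>Weak solutions\<close>

text \<open>
  The weak form of \<open>(-\<Delta>)\<^sup>s\<^sub>p u = \<lambda> \<alpha> f(u)\<close> in \<open>\<Omega>\<close> with \<open>u = 0\<close> outside \<open>\<Omega>\<close>.
  For \<open>p < 2\<close> the expression \<open>|t| powr (p - 2) * t\<close> is \<open>0\<close> at \<open>t = 0\<close>, its continuous extension.
\<close>

definition weak_solution ::
    "real \<Rightarrow> real \<Rightarrow> 'a::euclidean_space set \<Rightarrow> ('a \<Rightarrow> real) \<Rightarrow> (real \<Rightarrow> real) \<Rightarrow> real \<Rightarrow>
      ('a \<Rightarrow> real) \<Rightarrow> bool" where
  "weak_solution s p \<Omega> \<alpha> f lam u \<longleftrightarrow>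
     u \<in> X0 s p \<Omega> \<and>
     (\<forall>\<phi>\<in>X0 s p \<Omega>.
        (LINT (x, y)|lebesgue.
           \<bar>u x - u y\<bar> powr (p - 2) * (u x - u y) * (\<phi> x - \<phi> y) /
             norm (x - y) powr (real DIM('a) + p * s)) =
        lam * (LINT x|lebesgue_on \<Omega>. \<alpha> x * f (u x) * \<phi> x))"

definition primitive :: "(real \<Rightarrow> real) \<Rightarrow> real \<Rightarrow> real" where
  "primitive f t = (LBINT \<zeta>=0..ereal t. f \<zeta>)"

end

theory Submission
  imports Defs "HOL-Complex_Analysis.Great_Picard"
begin

text \<open>
  Let \<open>G u\<close> be the \<open>p\<close>-th power of the Gagliardo seminorm and let
  \<open>E u = G u / p - \<lambda> \<integral> \<alpha> F(u)\<close> be the energy, where \<open>F\<close> is the primitive of \<open>f\<close>.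
  Since \<open>p s > N\<close>, comparing averages over balls of radii \<open>2 ^ (- k)\<close> shows that the elements of the
  space have continuous representatives with \<open>\<bar>u\<bar> \<le> c \<parallel>u\<parallel>\<close> and a common modulus of continuity on bounded
  sets, so \<open>E\<close> attains its minimum on every closed ball. Because \<open>f \<ge> 0\<close>, the positive part of a minimiser
  is again a minimiser. If \<open>F t / t powr p\<close> is small, the minimiser on the ball of radius \<open>t / c\<close> is an
  interior point, hence a weak solution; the liminf condition provides such \<open>t\<close>. The limsup condition,
  tested on multiples of a cutoff function, forces the minimal energies to tend to \<open>-\<infinity>\<close> for \<open>L = \<infinity>\<close>,
  so the norms are unbounded, and to be negative for \<open>L = 0\<close>, so the minimisers are small but not zero.
\<close>

subsection \<open>Averages and the fractional Morrey estimate\<close>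

text \<open>For \<open>L = at_top\<close> the energy is unbounded below, so there is no global
  minimiser and the minimisation is restricted to balls. On the ball \<open>G u <= H powr p\<close>
  the sup bound gives \<open>Psi u <= A * F (c * H)\<close>, with \<open>A\<close> the integral of
  \<alpha>, hence boundedness below. Since a minimiser has \<open>E u <= E 0 = 0\<close>, it
  satisfies \<open>G u <= p * lam * A * F t\<close> for \<open>t = c * H\<close>, so interiority is
  a condition on \<open>F t / t powr p\<close> alone. Compactness comes from Arzela-Ascoli instead
  of weak compactness in a reflexive space; this is why the Morrey estimate has to deliver one
  modulus of continuity for a whole ball. The analysis is carried out with \<open>lborel\<close> and
  continuous functions (the set \<open>W\<close>); general elements of \<open>X0\<close>, in
  particular test functions, are exchanged for continuous ones almost everywhere. A sequence
  repeating a single solution has to be excluded, so the norms are made strictly monotone along the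
  sequence.\<close>

definition avg :: "('a::euclidean_space \<Rightarrow> real) \<Rightarrow> 'a set \<Rightarrow> real" where
  "avg u B = (LINT y:B|lborel. u y) / measure lborel B"

text \<open>
  With \<open>K\<close> chosen at the scale of the \<open>p\<close>-mean of \<open>a\<close>, averaging this inequality gives
  Jensen's inequality up to a factor \<open>2\<close>.
\<close>

lemma le_add_powr:
  fixes K p a :: real
  assumes "K > 0" "p \<ge> 1" "a \<ge> 0"
  shows "a \<le> K + K powr (1 - p) * a powr p"
proof (cases "a \<le> K")
  case True
  then show ?thesis by (smt (verit) mult_nonneg_nonneg powr_ge_zero)
next
  case False
  then have a: "a > K" "a > 0" using assms by auto
  have "a = a powr (1 - p) * a powr p" using a by (simp flip: powr_add)
  also have "\<dots> \<le> K powr (1 - p) * a powr p"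
    using a assms by (intro mult_right_mono powr_mono2') auto
  finally show ?thesis using assms by simp
qed

lemma gagliardo_nonneg [simp]: "gagliardo_integrand s p u z \<ge> 0"
  by (auto simp: gagliardo_integrand_def split: prod.splits)

lemma diff_powr_le_gagliardo:
  fixes u :: "'a::euclidean_space \<Rightarrow> real"
  assumes "norm (a - b) \<le> d" "s > 0" "p > 0"
  shows "\<bar>u a - u b\<bar> powr p \<le> d powr (real DIM('a) + p * s) * gagliardo_integrand s p u (a, b)"
proof (cases "a = b")
  case False
  then have n: "norm (a - b) > 0" by simp
  have "\<bar>u a - u b\<bar> powr p =
      norm (a - b) powr (real DIM('a) + p * s) * gagliardo_integrand s p u (a, b)"
    using n by (simp add: gagliardo_integrand_def)
  also have "\<dots> \<le> d powr (real DIM('a) + p * s) * gagliardo_integrand s p u (a, b)"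
    using assms by (intro mult_right_mono powr_mono2) auto
  finally show ?thesis .
qed (use assms in auto)

lemma gagliardo_borel [measurable]:
  fixes u :: "'a::euclidean_space \<Rightarrow> real"
  assumes [measurable]: "u \<in> borel_measurable borel"
  shows "gagliardo_integrand s p u \<in> borel_measurable borel"
proof -
  have "gagliardo_integrand s p u \<in> borel_measurable (borel \<Otimes>\<^sub>M borel)"
    unfolding gagliardo_integrand_def by measurable
  then show ?thesis by (simp add: borel_prod)
qed

text \<open>Integrating \<open>le_add_powr\<close> for \<open>|u a - u b|\<close> over
  \<open>b\<close> in \<open>B\<close> bounds the mean difference;
  \<open>diff_powr_le_gagliardo\<close> brings in the seminorm at the price of the power of
  \<open>d\<close>, and the integral over \<open>B\<close> is enlarged to the whole space. The level
  \<open>K\<close> stays free: it is fixed by scaling in \<open>avg_ball_diff_le\<close> and is an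
  arbitrary error in \<open>avg_ball_AE_tendsto\<close>.\<close>

lemma point_avg_le:
  fixes u :: "'a::euclidean_space \<Rightarrow> real"
  assumes u [measurable]: "u \<in> borel_measurable borel" and B [measurable]: "B \<in> sets borel"
    and fin: "emeasure lborel B < \<infinity>" and pos: "measure lborel B > 0"
    and int: "set_integrable lborel B u"
    and g: "integrable lborel (\<lambda>b. gagliardo_integrand s p u (a, b))"
    and d: "\<And>b. b \<in> B \<Longrightarrow> norm (a - b) \<le> d" and "K > 0" "p \<ge> 1" "s > 0"
  shows "\<bar>u a - avg u B\<bar> \<le> K + K powr (1 - p) * d powr (real DIM('a) + p * s) *
     (LINT b|lborel. gagliardo_integrand s p u (a, b)) / measure lborel B"
proof -
  define c where "c = K powr (1 - p) * d powr (real DIM('a) + p * s)"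
  have c0: "c \<ge> 0" by (simp add: c_def)
  have cB: "set_integrable lborel B (\<lambda>_. k)" for k :: real
    using fin B unfolding set_integrable_def by auto
  have gB: "set_integrable lborel B (\<lambda>b. gagliardo_integrand s p u (a, b))"
    using g B unfolding set_integrable_def by (intro integrable_mult_indicator) auto
  have dB: "set_integrable lborel B (\<lambda>b. u a - u b)"
    using cB int by (rule set_integral_diff)
  have "measure lborel B * (u a - avg u B) = (LINT b:B|lborel. u a - u b)"
    using pos int cB
    by (subst set_integral_diff) (auto simp: avg_def field_simps set_lebesgue_integral_def)
  also have "\<bar>\<dots>\<bar> \<le> (LINT b:B|lborel. \<bar>u a - u b\<bar>)"
    using set_integral_norm_bound[OF dB] by simp
  also have "\<dots> \<le> (LINT b:B|lborel. K + c * gagliardo_integrand s p u (a, b))"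
  proof (rule set_integral_mono)
    show "set_integrable lborel B (\<lambda>b. \<bar>u a - u b\<bar>)" using dB by (rule set_integrable_abs)
    show "set_integrable lborel B (\<lambda>b. K + c * gagliardo_integrand s p u (a, b))"
      using cB gB by (intro set_integral_add set_integrable_mult_right) auto
    fix b assume "b \<in> B"
    have "\<bar>u a - u b\<bar> \<le> K + K powr (1 - p) * \<bar>u a - u b\<bar> powr p"
      using assms by (intro le_add_powr) auto
    also have "K powr (1 - p) * \<bar>u a - u b\<bar> powr p \<le> c * gagliardo_integrand s p u (a, b)"
      unfolding c_def mult.assoc
      using assms d[OF \<open>b \<in> B\<close>] by (intro mult_left_mono diff_powr_le_gagliardo) auto
    finally show "\<bar>u a - u b\<bar> \<le> K + c * gagliardo_integrand s p u (a, b)" by simp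
  qed
  also have "\<dots> = K * measure lborel B + c * (LINT b:B|lborel. gagliardo_integrand s p u (a, b))"
    using cB gB by (subst set_integral_add) (auto simp: set_lebesgue_integral_def)
  also have "\<dots> \<le> K * measure lborel B + c * (LINT b|lborel. gagliardo_integrand s p u (a, b))"
    using g B c0 unfolding set_lebesgue_integral_def
    by (intro add_left_mono mult_left_mono integral_mono integrable_mult_indicator)
       (auto simp: indicator_def)
  finally have "measure lborel B * \<bar>u a - avg u B\<bar> \<le>
      K * measure lborel B + c * (LINT b|lborel. gagliardo_integrand s p u (a, b))"
    using pos by (simp add: abs_mult)
  then show ?thesis using pos by (simp add: c_def field_simps)
qed

text \<open>\<open>point_avg_le\<close> is averaged once more, over \<open>a\<close> in
  \<open>A\<close>. It is available only for almost every \<open>a\<close>, since Fubini gives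
  integrable slices only almost everywhere.\<close>

lemma avg_avg_le:
  fixes u :: "'a::euclidean_space \<Rightarrow> real"
  assumes u [measurable]: "u \<in> borel_measurable borel"
    and A [measurable]: "A \<in> sets borel" and B [measurable]: "B \<in> sets borel"
    and finA: "emeasure lborel A < \<infinity>" and posA: "measure lborel A > 0"
    and finB: "emeasure lborel B < \<infinity>" and posB: "measure lborel B > 0"
    and intA: "set_integrable lborel A u" and intB: "set_integrable lborel B u"
    and g: "integrable lborel (gagliardo_integrand s p u)"
    and d: "\<And>a b. a \<in> A \<Longrightarrow> b \<in> B \<Longrightarrow> norm (a - b) \<le> d" and "K > 0" "p \<ge> 1" "s > 0"
  shows "\<bar>avg u A - avg u B\<bar> \<le> K + K powr (1 - p) * d powr (real DIM('a) + p * s) *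
     (LINT z|lborel. gagliardo_integrand s p u z) / (measure lborel A * measure lborel B)"
proof -
  define c where "c = K powr (1 - p) * d powr (real DIM('a) + p * s) / measure lborel B"
  define h where "h a = (LINT b|lborel. gagliardo_integrand s p u (a, b))" for a
  have c0: "c \<ge> 0" by (simp add: c_def)
  have g2: "integrable (lborel \<Otimes>\<^sub>M lborel) (gagliardo_integrand s p u)"
    using g by (simp add: lborel_prod)
  have hint: "integrable lborel h"
    unfolding h_def by (rule lborel_pair.integrable_fst'[OF g2])
  have hG: "(LINT a|lborel. h a) = (LINT z|lborel. gagliardo_integrand s p u z)"
    unfolding h_def using lborel_pair.integral_fst'[OF g2] by (simp add: lborel_prod)
  have h0: "h a \<ge> 0" for a unfolding h_def by simp
  have cA: "set_integrable lborel A (\<lambda>_. k)" for k :: real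
    using finA A unfolding set_integrable_def by auto
  have hA: "set_integrable lborel A h"
    using hint A unfolding set_integrable_def by (intro integrable_mult_indicator) auto
  have dA: "set_integrable lborel A (\<lambda>a. u a - avg u B)"
    using intA cA by (rule set_integral_diff)
  have "measure lborel A * (avg u A - avg u B) = (LINT a:A|lborel. u a - avg u B)"
    using posA intA cA
    by (subst set_integral_diff) (auto simp: avg_def[of u A] field_simps set_lebesgue_integral_def)
  also have "\<bar>\<dots>\<bar> \<le> (LINT a:A|lborel. \<bar>u a - avg u B\<bar>)"
    using set_integral_norm_bound[OF dA] by simp
  also have "\<dots> \<le> (LINT a:A|lborel. K + c * h a)"
  proof (rule set_integral_mono_AE)
    show "set_integrable lborel A (\<lambda>a. \<bar>u a - avg u B\<bar>)" using dA by (rule set_integrable_abs)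
    show "set_integrable lborel A (\<lambda>a. K + c * h a)"
      using cA hA by (intro set_integral_add set_integrable_mult_right) auto
    have "AE a in lborel. integrable lborel (\<lambda>b. gagliardo_integrand s p u (a, b))"
      by (rule lborel_pair.AE_integrable_fst'[OF g2])
    then show "AE a\<in>A in lborel. \<bar>u a - avg u B\<bar> \<le> K + c * h a"
    proof eventually_elim
      case (elim a)
      show ?case
      proof
        assume "a \<in> A"
        then show "\<bar>u a - avg u B\<bar> \<le> K + c * h a"
          using point_avg_le[OF u B finB posB intB elim d \<open>K > 0\<close> \<open>p \<ge> 1\<close> \<open>s > 0\<close>]
          by (simp add: c_def h_def)
      qed
    qed
  qed
  also have "\<dots> = K * measure lborel A + c * (LINT a:A|lborel. h a)"
    using cA hA by (subst set_integral_add) (auto simp: set_lebesgue_integral_def)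
  also have "\<dots> \<le> K * measure lborel A + c * (LINT a|lborel. h a)"
    using hint A c0 h0 unfolding set_lebesgue_integral_def
    by (intro add_left_mono mult_left_mono integral_mono integrable_mult_indicator)
       (auto simp: indicator_def)
  finally have "measure lborel A * \<bar>avg u A - avg u B\<bar> \<le>
      K * measure lborel A + c * (LINT a|lborel. h a)"
    using posA by (simp add: abs_mult)
  then show ?thesis using posA posB unfolding hG by (simp add: c_def field_simps)
qed

lemma geometric_increments:
  fixes a :: "nat \<Rightarrow> real"
  assumes q: "0 < q" "q < 1" and a: "\<And>k. \<bar>a (Suc k) - a k\<bar> \<le> C * q ^ k"
  shows "convergent a" "\<bar>lim a - a k\<bar> \<le> C * q ^ k / (1 - q)"
proof -
  have "summable (\<lambda>k. a (Suc k) - a k)"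
  proof (rule summable_comparison_test'[where g = "\<lambda>k. C * q ^ k" and N = 0])
    show "summable (\<lambda>k. C * q ^ k)" using q by (intro summable_mult summable_geometric) auto
  qed (use a in auto)
  then have "convergent (\<lambda>n. a 0 + (\<Sum>k<n. a (Suc k) - a k))"
    by (intro convergent_add convergent_const) (simp add: summable_iff_convergent)
  then show conv: "convergent a" by (simp add: sum_lessThan_telescope)
  have C: "C \<ge> 0" using a[of 0] by auto
  \<comment> \<open>The factor \<open>1 - q ^ m\<close> is the exact partial geometric sum; with the
    plain bound 1 in its place the induction would not close.\<close>
  have bd: "\<bar>a (k + m) - a k\<bar> \<le> C * q ^ k * (1 - q ^ m) / (1 - q)" for m
  proof (induction m)
    case (Suc m)
    have "\<bar>a (k + Suc m) - a k\<bar> \<le> C * q ^ (k + m) + C * q ^ k * (1 - q ^ m) / (1 - q)"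
      using Suc a[of "k + m"] by simp
    also have "\<dots> = C * q ^ k * (1 - q ^ Suc m) / (1 - q)"
      using q by (simp add: field_simps power_add)
    finally show ?case .
  qed simp
  have "(\<lambda>m. \<bar>a (k + m) - a k\<bar>) \<longlonglongrightarrow> \<bar>lim a - a k\<bar>"
    using conv unfolding convergent_LIMSEQ_iff
    by (intro tendsto_intros) (use LIMSEQ_ignore_initial_segment[of a "lim a" k] in \<open>simp add: add.commute\<close>)
  moreover have "\<bar>a (k + m) - a k\<bar> \<le> C * q ^ k / (1 - q)" for m
  proof -
    have "C * q ^ k * (1 - q ^ m) / (1 - q) \<le> C * q ^ k * 1 / (1 - q)"
      using C q by (intro divide_right_mono mult_left_mono) auto
    then show ?thesis using bd[of m] by simp
  qed
  ultimately show "\<bar>lim a - a k\<bar> \<le> C * q ^ k / (1 - q)"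
    by (intro LIMSEQ_le_const2) auto
qed

lemma emeasure_ball_less_top: "emeasure lborel (ball (x :: 'a::euclidean_space) r) < top"
  using emeasure_lborel_ball_finite[of x r] by simp

text \<open>\<open>le_add_powr\<close> with \<open>K = 1\<close> dominates \<open>|u|\<close> by
  \<open>1 + |u| powr p\<close>, and the ball has finite measure.\<close>

lemma locally_integrable_of_powr:
  fixes u :: "'a::euclidean_space \<Rightarrow> real"
  assumes u [measurable]: "u \<in> borel_measurable borel" and "p \<ge> 1"
    and "integrable lborel (\<lambda>x. \<bar>u x\<bar> powr p)"
  shows "set_integrable lborel (ball x r) u"
proof -
  have "integrable lborel (\<lambda>y. indicator (ball x r) y + \<bar>u y\<bar> powr p)"
    using assms by (intro Bochner_Integration.integrable_add integrable_real_indicator)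
      (auto simp: emeasure_ball_less_top)
  then show ?thesis unfolding set_integrable_def
  proof (rule Bochner_Integration.integrable_bound)
    show "AE y in lborel. norm (indicator (ball x r) y *\<^sub>R u y) \<le>
        norm (indicator (ball x r) y + \<bar>u y\<bar> powr p)"
      using le_add_powr[of 1 p] \<open>p \<ge> 1\<close> by (auto simp: indicator_def)
    show "(\<lambda>y. indicator (ball x r) y *\<^sub>R u y) \<in> borel_measurable lborel"
      using u by (intro borel_measurable_scaleR borel_measurable_indicator) auto
  qed
qed

text \<open>\<open>K\<close> is chosen such that both terms of \<open>avg_avg_le\<close> are at most
  \<open>K\<close>, whence the factor 2. Its power of \<open>r\<close> is
  \<open>(DIM('a) + p * s - 2 * DIM('a)) / p = s - DIM('a) / p\<close>, the kernel against the two
  volumes. The two values of \<rho> serve the two later comparisons: equal balls with different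
  centres, and a ball with its concentric half; \<open>2 ^ DIM('a)\<close> pays for the half.
  \<open>H\<close> bounds the seminorm and is positive so that \<open>K\<close> is.\<close>

lemma avg_ball_diff_le:
  fixes u :: "'a::euclidean_space \<Rightarrow> real"
  assumes u [measurable]: "u \<in> borel_measurable borel"
    and up: "integrable lborel (\<lambda>x. \<bar>u x\<bar> powr p)"
    and g: "integrable lborel (gagliardo_integrand s p u)"
    and GH: "(LINT z|lborel. gagliardo_integrand s p u z) \<le> H powr p" and "H > 0"
    and "p > 1" "s > 0" and r: "r > 0" and \<rho>: "\<rho> = r \<or> \<rho> = r / 2"
    and xy: "dist x y \<le> D * r" and "D \<ge> 0"
  shows "\<bar>avg u (ball x r) - avg u (ball y \<rho>)\<bar> \<le>
     2 * ((D + 2) powr (real DIM('a) + p * s) * 2 ^ DIM('a) / (unit_ball_vol (real DIM('a)))\<^sup>2) powr (1 / p)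
       * r powr (s - real DIM('a) / p) * H"
proof -
  define E where "E = real DIM('a) + p * s"
  define w where "w = unit_ball_vol (real DIM('a))"
  define K where "K = ((D + 2) powr E * 2 ^ DIM('a) / w\<^sup>2) powr (1 / p) * r powr (s - real DIM('a) / p) * H"
  have w: "w > 0" by (simp add: w_def)
  have K: "K > 0" unfolding K_def using w r assms by (intro mult_pos_pos) auto
  have \<rho>0: "\<rho> > 0" "\<rho> \<le> r" using \<rho> r by auto
  let ?G = "LINT z|lborel. gagliardo_integrand s p u z"
  let ?m = "measure lborel (ball x r) * measure lborel (ball y \<rho>)"
  have mx: "measure lborel (ball x r) = w * r ^ DIM('a)"
    using r by (simp add: content_ball w_def)
  have my: "measure lborel (ball y \<rho>) = w * \<rho> ^ DIM('a)"
    using \<rho>0 by (simp add: content_ball w_def)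
  have m: "?m > 0" unfolding mx my using w r \<rho>0 by simp
  have le: "\<bar>avg u (ball x r) - avg u (ball y \<rho>)\<bar> \<le>
      K + K powr (1 - p) * ((D + 2) * r) powr E * ?G / ?m"
    unfolding E_def
  proof (rule avg_avg_le)
    fix a b assume "a \<in> ball x r" "b \<in> ball y \<rho>"
    then have "dist x a < r" "dist y b < r" using \<rho>0 by auto
    then have "dist a b < r + D * r + r"
      using xy dist_triangle[of a b x] dist_triangle[of x b y] by (simp add: dist_commute)
    then show "norm (a - b) \<le> (D + 2) * r" by (simp add: dist_norm algebra_simps)
  qed (use assms K \<rho>0 w in \<open>auto simp: mx my emeasure_ball_less_top
        intro!: locally_integrable_of_powr[OF u _ up]\<close>)
  have sp: "(s - real DIM('a) / p) * p = p * s - real DIM('a)" using \<open>p > 1\<close> by (simp add: field_simps)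
  have "K powr p = (D + 2) powr E * 2 ^ DIM('a) / w\<^sup>2 * r powr (p * s - real DIM('a)) * H powr p"
    unfolding K_def using assms w
    by (simp add: powr_mult powr_powr powr_divide sp)
  then have "K powr p * ?m =
      (D + 2) powr E * H powr p * (r powr (p * s - real DIM('a)) * r ^ DIM('a) * ((2 * \<rho>) ^ DIM('a)))"
    unfolding mx my using w by (simp add: power2_eq_square power_mult_distrib)
  also have "\<dots> \<ge> (D + 2) powr E * H powr p * (r powr (p * s - real DIM('a)) * r ^ DIM('a) * (r ^ DIM('a)))"
    using r \<rho> by (intro mult_left_mono power_mono mult_nonneg_nonneg) auto
  also have "r powr (p * s - real DIM('a)) * r ^ DIM('a) * (r ^ DIM('a)) = r powr E"
    using r unfolding E_def by (simp flip: powr_realpow powr_add add: add.commute)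
  also have "(D + 2) powr E * H powr p * r powr E \<ge> ((D + 2) * r) powr E * ?G"
    using GH r \<open>D \<ge> 0\<close> by (auto simp: powr_mult intro!: mult_left_mono)
  finally have "((D + 2) * r) powr E * ?G \<le> K powr p * ?m" by simp
  then have "K powr (1 - p) * (((D + 2) * r) powr E * ?G) \<le> K powr (1 - p) * (K powr p * ?m)"
    by (intro mult_left_mono) auto
  also have "\<dots> = K * ?m" using K by (simp flip: powr_add add: mult.assoc[symmetric])
  finally have "K powr (1 - p) * ((D + 2) * r) powr E * ?G / ?m \<le> K"
    using m by (subst pos_divide_le_eq) (auto simp: mult.assoc)
  with le have "\<bar>avg u (ball x r) - avg u (ball y \<rho>)\<bar> \<le> 2 * K" by simp
  then show ?thesis by (simp add: K_def E_def w_def)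
qed

text \<open>Plays the part of Lebesgue's differentiation theorem. At a point whose slice is
  integrable, \<open>point_avg_le\<close> with radius \<open>r\<close> and level \<open>e\<close>
  leaves, besides \<open>e\<close>, an error of order \<open>r powr (p * s)\<close>, because the
  volume cancels the factor \<open>r ^ DIM('a)\<close> of the kernel.\<close>

lemma avg_ball_AE_tendsto:
  fixes u :: "'a::euclidean_space \<Rightarrow> real"
  assumes u [measurable]: "u \<in> borel_measurable borel"
    and up: "integrable lborel (\<lambda>x. \<bar>u x\<bar> powr p)"
    and g: "integrable lborel (gagliardo_integrand s p u)"
    and "p > 1" "s > 0"
  shows "AE x in lborel. (\<lambda>k. avg u (ball x (1 / 2 ^ k))) \<longlonglongrightarrow> u x"
proof -
  have g2: "integrable (lborel \<Otimes>\<^sub>M lborel) (gagliardo_integrand s p u)"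
    using g by (simp add: lborel_prod)
  show ?thesis using lborel_pair.AE_integrable_fst'[OF g2]
  proof eventually_elim
    case (elim x)
    define h where "h = (LINT b|lborel. gagliardo_integrand s p u (x, b))"
    define w where "w = unit_ball_vol (real DIM('a))"
    have w: "w > 0" by (simp add: w_def)
    have le: "\<bar>u x - avg u (ball x (1 / 2 ^ k))\<bar> \<le>
        e + e powr (1 - p) * (1 / 2 ^ k) powr (p * s) * h / w" if "e > 0" for e :: real and k
    proof -
      define r where "r = (1 / 2 ^ k :: real)"
      have r: "r > 0" by (simp add: r_def)
      have m: "measure lborel (ball x r) = w * r ^ DIM('a)"
        using r by (simp add: content_ball w_def)
      have "\<bar>u x - avg u (ball x r)\<bar> \<le> e + e powr (1 - p) * r powr (real DIM('a) + p * s) *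
          (LINT b|lborel. gagliardo_integrand s p u (x, b)) / measure lborel (ball x r)"
        by (rule point_avg_le)
           (use assms r w that elim in \<open>auto simp: m emeasure_ball_less_top dist_norm
              intro!: locally_integrable_of_powr[OF u _ up]\<close>)
      also have "\<dots> = e + e powr (1 - p) * r powr (p * s) * h / w"
        using r w by (simp add: m h_def powr_add powr_realpow)
      finally show ?thesis by (simp add: r_def)
    qed
    show ?case
    proof (rule LIMSEQ_I)
      fix e :: real assume "e > 0"
      have "(\<lambda>k. e / 2 + (e / 2) powr (1 - p) * (1 / 2 ^ k) powr (p * s) * h / w)
          \<longlonglongrightarrow> e / 2 + (e / 2) powr (1 - p) * 0 powr (p * s) * h / w"
        using assms w by (intro tendsto_intros tendsto_powr') (auto intro: LIMSEQ_divide_realpow_zero)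
      from order_tendstoD(2)[OF this, of e]
      have "\<forall>\<^sub>F k in sequentially. e / 2 + (e / 2) powr (1 - p) * (1 / 2 ^ k) powr (p * s) * h / w < e"
        using \<open>e > 0\<close> by simp
      then have "\<forall>\<^sub>F k in sequentially. norm (avg u (ball x (1 / 2 ^ k)) - u x) < e"
      proof eventually_elim
        case (elim k)
        show ?case using le[of "e/2" k] elim \<open>e > 0\<close> by simp
      qed
      then show "\<exists>no. \<forall>k\<ge>no. norm (avg u (ball x (1 / 2 ^ k)) - u x) < e"
        by (simp add: eventually_sequentially)
    qed
  qed
qed

text \<open>\<open>v\<close> is the pointwise limit of the averages over balls of radius
  \<open>1 / 2 ^ k\<close>. For points at distance at most \<open>1 / 2 ^ k\<close>,
  \<open>v x - v y\<close> splits into two geometric tails and one difference of averages at level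
  \<open>k\<close>. For the sup bound, the unit ball about \<open>x\<close> is compared with a unit
  ball on which \<open>u\<close> vanishes. \<open>H\<close> is quantified after \<open>v\<close>, so
  one representative serves all bounds.\<close>

lemma morrey:
  fixes s p R :: real
  assumes p: "p > 1" and s: "s > 0" and ps: "p * s > real DIM('a::euclidean_space)" and R: "R > 0"
  obtains C q where "C > 0" "0 < q" "q < 1"
    "\<And>u :: 'a \<Rightarrow> real. \<lbrakk>u \<in> borel_measurable borel; integrable lborel (\<lambda>x. \<bar>u x\<bar> powr p);
       integrable lborel (gagliardo_integrand s p u); AE x in lborel. norm x > R \<longrightarrow> u x = 0\<rbrakk> \<Longrightarrow>
       \<exists>v. (AE x in lborel. u x = v x) \<and>
           (\<forall>H>0. (LINT z|lborel. gagliardo_integrand s p u z) \<le> H powr p \<longrightarrow>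
              (\<forall>x. \<bar>v x\<bar> \<le> C * H) \<and>
              (\<forall>k x y. dist x y \<le> 1 / 2 ^ k \<longrightarrow> \<bar>v x - v y\<bar> \<le> C * q ^ k * H))"
proof -
  define Cd where "Cd D = 2 * ((D + 2) powr (real DIM('a) + p * s) * 2 ^ DIM('a) /
      (unit_ball_vol (real DIM('a)))\<^sup>2) powr (1 / p)" for D :: real
  define \<gamma> where "\<gamma> = s - real DIM('a) / p"
  \<comment> \<open>Halving the radius multiplies \<open>r powr \<gamma>\<close> by
    \<open>q\<close>, and \<open>q < 1\<close> expresses \<open>p * s > DIM('a)\<close>.\<close>
  define q :: real where "q = 2 powr (- \<gamma>)"
  have \<gamma>: "\<gamma> > 0" using ps p by (simp add: \<gamma>_def field_simps)
  have q: "0 < q" "q < 1" using \<gamma> by (auto simp: q_def powr_less_one)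
  have qk: "(1 / 2 ^ k) powr \<gamma> = q ^ k" for k
  proof -
    have "(1 / 2 ^ k) powr \<gamma> = (2 powr (- real k)) powr \<gamma>"
      by (simp add: powr_minus powr_realpow divide_inverse)
    also have "\<dots> = q powr real k" by (simp add: q_def powr_powr mult.commute)
    finally show ?thesis using q by (simp add: powr_realpow)
  qed
  have Cd: "Cd D > 0" if "D \<ge> 0" for D
  proof -
    have "unit_ball_vol (real DIM('a)) > 0" by simp
    then have "unit_ball_vol (real DIM('a)) \<noteq> 0" by linarith
    then show ?thesis using that unfolding Cd_def by (intro mult_pos_pos powr_gt_zero[THEN iffD2]) auto
  qed
  \<comment> \<open>A point of norm below \<open>R + 1\<close> has distance at most
    \<open>2 * R + 2\<close> from a point of norm \<open>R + 1\<close>. In \<open>C\<close> below,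
    the first summand serves the modulus and the other two the sup bound.\<close>
  define D where "D = 2 * R + 2"
  define C where "C = Cd 1 * (1 + 2 / (1 - q)) + Cd D + Cd 1 / (1 - q)"
  have Cpos: "C > 0" "Cd 1 * (1 + 2 / (1 - q)) \<le> C" "Cd D + Cd 1 / (1 - q) \<le> C"
    using Cd[of 1] Cd[of D] q R by (auto simp: C_def D_def intro!: add_nonneg_nonneg add_pos_nonneg mult_pos_pos)
  show ?thesis
  proof (rule that[OF Cpos(1) q])
    fix u :: "'a \<Rightarrow> real"
    assume u: "u \<in> borel_measurable borel" "integrable lborel (\<lambda>x. \<bar>u x\<bar> powr p)"
       "integrable lborel (gagliardo_integrand s p u)" and u0: "AE x in lborel. norm x > R \<longrightarrow> u x = 0"
    define a where "a x k = avg u (ball x (1 / 2 ^ k))" for x k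
    define v where "v x = lim (a x)" for x
    have "AE x in lborel. u x = v x"
      using avg_ball_AE_tendsto[OF u p s]
    proof eventually_elim
      case (elim x)
      have "a x = (\<lambda>k. avg u (ball x (1 / 2 ^ k)))" by (rule ext) (simp add: a_def)
      then show ?case using limI[OF elim] by (simp add: v_def)
    qed
    moreover have "(\<forall>x. \<bar>v x\<bar> \<le> C * H) \<and>
        (\<forall>k x y. dist x y \<le> 1 / 2 ^ k \<longrightarrow> \<bar>v x - v y\<bar> \<le> C * q ^ k * H)"
      if H: "H > 0" "(LINT z|lborel. gagliardo_integrand s p u z) \<le> H powr p" for H
    proof -
      note base = avg_ball_diff_le[OF u H(2,1) p s, folded Cd_def \<gamma>_def]
      have same: "\<bar>a x k - a y k\<bar> \<le> Cd 1 * q ^ k * H" if "dist x y \<le> 1 / 2 ^ k" for x y k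
        using base[of "1 / 2 ^ k" "1 / 2 ^ k" x y 1] that by (simp add: a_def qk)
      have step: "\<bar>a x (Suc k) - a x k\<bar> \<le> (Cd 1 * H) * q ^ k" for x k
        using base[of "1 / 2 ^ k" "1 / 2 ^ Suc k" x x 1]
        by (simp add: a_def qk abs_minus_commute mult_ac)
      have va: "\<bar>v x - a x k\<bar> \<le> Cd 1 * q ^ k * H / (1 - q)" for x k
        using geometric_increments(2)[where a = "a x" and k = k, OF q step] unfolding v_def by (simp add: mult_ac)
      have "\<bar>v x - v y\<bar> \<le> C * q ^ k * H" if xy: "dist x y \<le> 1 / 2 ^ k" for x y k
      proof -
        have "\<bar>v x - v y\<bar> \<le> Cd 1 * q ^ k * H + 2 * (Cd 1 * q ^ k * H / (1 - q))"
          using va[of x k] va[of y k] same[OF xy] by linarith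
        also have "\<dots> = (Cd 1 * (1 + 2 / (1 - q))) * (q ^ k * H)" by (simp add: algebra_simps)
        also have "\<dots> \<le> C * (q ^ k * H)"
          using Cpos q H by (intro mult_right_mono) auto
        finally show ?thesis by (simp add: mult.assoc)
      qed
      moreover have "\<bar>v x\<bar> \<le> C * H" for x
      proof -
        \<comment> \<open>The unit ball about \<open>z\<close> lies where the norm exceeds
          \<open>R\<close>, so the average of \<open>u\<close> over it is 0.\<close>
        obtain z where z: "norm z \<ge> R + 1" "dist x z \<le> D"
        proof (cases "norm x \<ge> R + 1")
          case True
          then show ?thesis using R by (intro that[of x]) (auto simp: D_def)
        next
          case False
          obtain e :: 'a where e: "e \<in> Basis" using nonempty_Basis by blast
          have "dist x ((R + 1) *\<^sub>R e) \<le> norm x + norm ((R + 1) *\<^sub>R e)"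
            unfolding dist_norm by (rule norm_triangle_ineq4)
          then show ?thesis using False R e by (intro that[of "(R + 1) *\<^sub>R e"]) (auto simp: D_def)
        qed
        have "(LINT y:ball z 1|lborel. u y) = (LINT y:ball z 1|lborel. 0)"
          unfolding set_lebesgue_integral_def
        proof (rule integral_cong_AE)
          show "AE y in lborel. indicator (ball z 1) y *\<^sub>R u y = indicator (ball z 1) y *\<^sub>R 0"
            using u0
          proof eventually_elim
            case (elim y)
            have "norm y > R" if "y \<in> ball z 1"
              using that z norm_triangle_ineq2[of z y] by (auto simp: dist_norm)
            then show ?case using elim by (auto simp: indicator_def)
          qed
        qed (use u in \<open>auto intro!: borel_measurable_times borel_measurable_indicator\<close>)
        then have az: "a z 0 = 0" by (simp add: a_def avg_def)
        have "\<bar>a x 0\<bar> \<le> Cd D * H"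
          using base[of 1 1 x z D] z R az by (simp add: a_def D_def)
        moreover have "\<bar>v x - a x 0\<bar> \<le> Cd 1 * H / (1 - q)" using va[of x 0] by simp
        ultimately have "\<bar>v x\<bar> \<le> (Cd D + Cd 1 / (1 - q)) * H" by (simp add: algebra_simps)
        also have "\<dots> \<le> C * H" using Cpos H by (intro mult_right_mono) auto
        finally show ?thesis .
      qed
      ultimately show ?thesis by blast
    qed
    ultimately show "\<exists>v. (AE x in lborel. u x = v x) \<and>
           (\<forall>H>0. (LINT z|lborel. gagliardo_integrand s p u z) \<le> H powr p \<longrightarrow>
              (\<forall>x. \<bar>v x\<bar> \<le> C * H) \<and>
              (\<forall>k x y. dist x y \<le> 1 / 2 ^ k \<longrightarrow> \<bar>v x - v y\<bar> \<le> C * q ^ k * H))"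
      by blast
  qed
qed

subsection \<open>Lipschitz functions have finite Gagliardo seminorm\<close>

lemma dyadic_interval:
  fixes d :: real
  assumes "d \<ge> 1"
  obtains n :: nat where "2 ^ n \<le> d" "d < 2 * 2 ^ n"
proof -
  define n where "n = nat \<lfloor>log 2 d\<rfloor>"
  have "log 2 d \<ge> 0" using assms by simp
  then have n: "real n \<le> log 2 d" "log 2 d < real n + 1" by (auto simp: n_def)
  have "2 powr real n \<le> d" using n assms by (simp add: le_log_iff)
  moreover have "d < 2 powr (real n + 1)" using n assms by (simp add: log_less_iff)
  ultimately show ?thesis using that[of n] by (simp add: powr_realpow powr_add)
qed

lemma le_suminf_ennreal: "f n \<le> (\<Sum>n. f n)" for f :: "nat \<Rightarrow> ennreal"
  using sum_le_suminf[of f "{n}"] by simp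

text \<open>
  Dyadic shells replace polar coordinates: near \<open>x\<close> the shell of radius \<open>2 ^ (- n)\<close> contributes
  \<open>2 powr (- n * p * (1 - s))\<close>, far from \<open>x\<close> the shell of radius \<open>2 ^ n\<close> contributes \<open>2 powr (- n * p * s)\<close>.
\<close>

lemma nn_integral_kernel_finite:
  fixes s p :: real
  assumes "0 < s" "s < 1" "p > 0"
  obtains K :: real where "\<And>x :: 'a::euclidean_space.
    (\<integral>\<^sup>+y. ennreal (min 1 (norm (x - y)) powr p / norm (x - y) powr (real DIM('a) + p * s)) \<partial>lborel) \<le> ennreal K"
proof -
  define E where "E = real DIM('a) + p * s"
  define w where "w = unit_ball_vol (real DIM('a))"
  define a where "a n = 2 powr E * w * 2 ^ DIM('a) * (2 powr (- (p * (1 - s)))) ^ n" for n :: nat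
  define b where "b n = w * 2 ^ DIM('a) * (2 powr (- (p * s))) ^ n" for n :: nat
  have w: "w > 0" by (simp add: w_def)
  have E: "E > 0" using assms by (simp add: E_def add_pos_pos)
  have [measurable]: "ball x r \<in> sets borel" for x :: 'a and r by simp
  have sa: "summable a" unfolding a_def
    using assms by (intro summable_mult summable_geometric) (simp add: powr_less_one)
  have sb: "summable b" unfolding b_def
    using assms by (intro summable_mult summable_geometric) (simp add: powr_less_one)
  have a0: "a n \<ge> 0" and b0: "b n \<ge> 0" for n using w by (auto simp: a_def b_def)
  \<comment> \<open>\<open>A n\<close> and \<open>B n\<close> bound the kernel on the shells
    \<open>1 / (2 * 2 ^ n) < norm (x - y) <= 1 / 2 ^ n\<close> and
    \<open>2 ^ n <= norm (x - y) < 2 * 2 ^ n\<close>: the numerator is taken at the largest, the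
    denominator at the smallest radius.\<close>
  define A where "A n = (1 / 2 ^ n) powr p / (1 / (2 * 2 ^ n)) powr E" for n :: nat
  define B where "B n = 1 / (2 ^ n) powr E" for n :: nat
  have AB0: "A n \<ge> 0" "B n \<ge> 0" for n by (auto simp: A_def B_def)
  have two: "2 ^ n = 2 powr real n" for n :: nat by (simp add: powr_realpow)
  have Aa: "A n * (w * (2 * (1 / 2 ^ n)) ^ DIM('a)) = a n" for n
    unfolding A_def a_def E_def two[of n]
    by (simp add: powr_divide powr_mult powr_powr power_divide power_mult_distrib powr_add field_simps
        flip: powr_realpow)
       (simp add: powr_add[symmetric] algebra_simps flip: powr_realpow powr_diff)
  have Bb: "B n * (w * (2 * 2 ^ n) ^ DIM('a)) = b n" for n
    unfolding B_def b_def E_def two[of n]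
    by (simp add: powr_divide powr_mult powr_powr power_divide power_mult_distrib powr_add field_simps
        flip: powr_realpow)
       (simp add: powr_add[symmetric] algebra_simps flip: powr_realpow powr_diff)
  let ?k = "\<lambda>x y :: 'a. min 1 (norm (x - y)) powr p / norm (x - y) powr E"
  \<comment> \<open>Open balls containing the shells replace them, so that only volumes of balls
    occur; the doubled radius in the first sum covers the sphere
    \<open>norm (x - y) = 1 / 2 ^ n\<close>.\<close>
  have pw: "ennreal (?k x y) \<le> (\<Sum>n. ennreal (A n) * indicator (ball x (2 * (1 / 2 ^ n))) y)
      + (\<Sum>n. ennreal (B n) * indicator (ball x (2 * 2 ^ n)) y)" for x y
  proof -
    define d where "d = norm (x - y)"
    consider "d = 0" | "0 < d" "d < 1" | "d \<ge> 1" unfolding d_def by (smt (verit) norm_ge_zero)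
    then show ?thesis
    proof cases
      case 1
      then show ?thesis using assms by (simp add: d_def)
    next
      case 2
      then have "1 / d \<ge> 1" by simp
      then obtain n where n: "2 ^ n \<le> 1 / d" "1 / d < 2 * 2 ^ n" by (rule dyadic_interval)
      have d: "d \<le> 1 / 2 ^ n" "1 / (2 * 2 ^ n) < d"
        using n 2 by (auto simp: field_simps)
      have "?k x y = d powr p / d powr E" using 2 by (simp add: d_def min_def)
      also have "\<dots> \<le> A n" unfolding A_def
        using d 2 E assms by (intro frac_le powr_mono2 powr_gt_zero[THEN iffD2]) auto
      finally have "ennreal (?k x y) \<le> ennreal (A n) * indicator (ball x (2 * (1 / 2 ^ n))) y"
        using d 2 by (auto simp: indicator_def dist_norm d_def[symmetric] intro!: ennreal_leI)
      also have "\<dots> \<le> (\<Sum>n. ennreal (A n) * indicator (ball x (2 * (1 / 2 ^ n))) y)"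
        by (rule le_suminf_ennreal)
      finally show ?thesis by (simp add: add_increasing2)
    next
      case 3
      then obtain n where n: "2 ^ n \<le> d" "d < 2 * 2 ^ n" by (rule dyadic_interval)
      have "?k x y = 1 / d powr E" using 3 by (simp add: d_def min_def)
      also have "\<dots> \<le> B n" unfolding B_def
        using n 3 E assms by (intro frac_le powr_mono2 powr_gt_zero[THEN iffD2]) auto
      finally have "ennreal (?k x y) \<le> ennreal (B n) * indicator (ball x (2 * 2 ^ n)) y"
        using n 3 by (auto simp: indicator_def dist_norm d_def[symmetric] intro!: ennreal_leI)
      also have "\<dots> \<le> (\<Sum>n. ennreal (B n) * indicator (ball x (2 * 2 ^ n)) y)"
        by (rule le_suminf_ennreal)
      finally show ?thesis by (simp add: add_increasing)
    qed
  qed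
  have sumA: "(\<integral>\<^sup>+y. (\<Sum>n. ennreal (A n) * indicator (ball x (2 * (1 / 2 ^ n))) y) \<partial>lborel) = ennreal (suminf a)"
    for x :: 'a
  proof -
    have "(\<integral>\<^sup>+y. (\<Sum>n. ennreal (A n) * indicator (ball x (2 * (1 / 2 ^ n))) y) \<partial>lborel) =
       (\<Sum>n. \<integral>\<^sup>+y. ennreal (A n) * indicator (ball x (2 * (1 / 2 ^ n))) y \<partial>lborel)"
      by (rule nn_integral_suminf) measurable
    also have "\<dots> = (\<Sum>n. ennreal (a n))"
    proof (rule suminf_cong)
      fix n
      have "(\<integral>\<^sup>+y. ennreal (A n) * indicator (ball x (2 * (1 / 2 ^ n))) y \<partial>lborel) =
          ennreal (A n) * ennreal (w * (2 * (1 / 2 ^ n)) ^ DIM('a))"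
        by (subst nn_integral_cmult_indicator) (auto simp: emeasure_ball w_def)
      also have "\<dots> = ennreal (a n)"
        using AB0 w by (simp flip: Aa add: ennreal_mult)
      finally show "(\<integral>\<^sup>+y. ennreal (A n) * indicator (ball x (2 * (1 / 2 ^ n))) y \<partial>lborel) = ennreal (a n)" .
    qed
    also have "\<dots> = ennreal (suminf a)" using a0 sa by (rule suminf_ennreal2)
    finally show ?thesis .
  qed
  have sumB: "(\<integral>\<^sup>+y. (\<Sum>n. ennreal (B n) * indicator (ball x (2 * 2 ^ n)) y) \<partial>lborel) = ennreal (suminf b)"
    for x :: 'a
  proof -
    have "(\<integral>\<^sup>+y. (\<Sum>n. ennreal (B n) * indicator (ball x (2 * 2 ^ n)) y) \<partial>lborel) =
       (\<Sum>n. \<integral>\<^sup>+y. ennreal (B n) * indicator (ball x (2 * 2 ^ n)) y \<partial>lborel)"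
      by (rule nn_integral_suminf) measurable
    also have "\<dots> = (\<Sum>n. ennreal (b n))"
    proof (rule suminf_cong)
      fix n
      have "(\<integral>\<^sup>+y. ennreal (B n) * indicator (ball x (2 * 2 ^ n)) y \<partial>lborel) =
          ennreal (B n) * ennreal (w * (2 * 2 ^ n) ^ DIM('a))"
        by (subst nn_integral_cmult_indicator) (auto simp: emeasure_ball w_def)
      also have "\<dots> = ennreal (b n)"
        using AB0 w by (simp flip: Bb add: ennreal_mult)
      finally show "(\<integral>\<^sup>+y. ennreal (B n) * indicator (ball x (2 * 2 ^ n)) y \<partial>lborel) = ennreal (b n)" .
    qed
    also have "\<dots> = ennreal (suminf b)" using b0 sb by (rule suminf_ennreal2)
    finally show ?thesis .
  qed
  have "(\<integral>\<^sup>+y. ennreal (?k x y) \<partial>lborel) \<le> ennreal (suminf a + suminf b)" for x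
  proof -
    have "(\<integral>\<^sup>+y. ennreal (?k x y) \<partial>lborel) \<le>
       (\<integral>\<^sup>+y. (\<Sum>n. ennreal (A n) * indicator (ball x (2 * (1 / 2 ^ n))) y)
      + (\<Sum>n. ennreal (B n) * indicator (ball x (2 * 2 ^ n)) y) \<partial>lborel)"
      by (intro nn_integral_mono pw)
    also have "\<dots> = ennreal (suminf a) + ennreal (suminf b)"
      by (subst nn_integral_add) (measurable, simp only: sumA sumB)
    finally show ?thesis using suminf_nonneg[OF sa a0] suminf_nonneg[OF sb b0] by simp
  qed
  then show ?thesis by (intro that[of "suminf a + suminf b"]) (simp add: E_def)
qed

text \<open>\<open>w x - w y\<close> vanishes unless one of the points lies in \<open>S\<close>, so
  the integrand is dominated by the kernel on \<open>S\<close> times the whole space and on its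
  mirror image. Fubini and the uniform slice bound of \<open>nn_integral_kernel_finite\<close>
  finish. The \<open>min 1\<close> joins the Lipschitz bound near the diagonal with boundedness far
  from it.\<close>

lemma gagliardo_integrable_of_lipschitz:
  fixes w :: "'a::euclidean_space \<Rightarrow> real"
  assumes "0 < s" "s < 1" "p > 0" and w [measurable]: "w \<in> borel_measurable borel"
    and lip: "\<And>x y. \<bar>w x - w y\<bar> \<le> M * min 1 (norm (x - y))"
    and S [measurable]: "S \<in> sets borel" and fin: "emeasure lborel S < \<infinity>"
    and zero: "\<And>x. x \<notin> S \<Longrightarrow> w x = 0"
  shows "integrable lborel (gagliardo_integrand s p w)"
proof -
  define k where "k = (\<lambda>(x, y :: 'a). ennreal (min 1 (norm (x - y)) powr p / norm (x - y) powr (real DIM('a) + p * s)))"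
  obtain K :: real where K: "\<And>x. (\<integral>\<^sup>+y. k (x, y) \<partial>lborel) \<le> ennreal K"
    using nn_integral_kernel_finite[OF assms(1-3)] unfolding k_def by auto
  have K': "(\<integral>\<^sup>+x. k (x, y) \<partial>lborel) \<le> ennreal K" for y
    using K[of y] by (simp add: k_def norm_minus_commute)
  have k [measurable]: "k \<in> borel_measurable (lborel \<Otimes>\<^sub>M lborel)"
    unfolding k_def by measurable
  have Mnn: "M \<ge> 0"
  proof -
    obtain e :: 'a where "e \<in> Basis" using nonempty_Basis by blast
    then show ?thesis using lip[of e 0] by simp
  qed
  have le: "ennreal (gagliardo_integrand s p w z) \<le>
      ennreal (M powr p) * (indicator S (fst z) * k z + indicator S (snd z) * k z)" for z
  proof (cases z)
    case (Pair x y)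
    have "gagliardo_integrand s p w (x, y) \<le>
        M powr p * (min 1 (norm (x - y)) powr p / norm (x - y) powr (real DIM('a) + p * s))"
    proof -
      have "\<bar>w x - w y\<bar> powr p \<le> (M * min 1 (norm (x - y))) powr p"
        using assms by (intro powr_mono2) auto
      also have "\<dots> = M powr p * min 1 (norm (x - y)) powr p" using Mnn by (simp add: powr_mult)
      finally show ?thesis by (simp add: gagliardo_integrand_def divide_right_mono)
    qed
    then have *: "ennreal (gagliardo_integrand s p w z) \<le> ennreal (M powr p) * k z"
      unfolding k_def Pair by (simp add: ennreal_leI flip: ennreal_mult)
    show ?thesis
    proof (cases "x \<in> S \<or> y \<in> S")
      case True
      then have "k z \<le> indicator S (fst z) * k z + indicator S (snd z) * k z"
        by (auto simp: Pair indicator_def)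
      then show ?thesis using * by (meson mult_left_mono order_trans zero_le)
    next
      case False
      then show ?thesis using zero \<open>p > 0\<close> by (simp add: Pair gagliardo_integrand_def)
    qed
  qed
  have 1: "(\<integral>\<^sup>+z. indicator S (fst z) * k z \<partial>(lborel \<Otimes>\<^sub>M lborel)) \<le> ennreal K * emeasure lborel S"
  proof -
    have "(\<integral>\<^sup>+z. indicator S (fst z) * k z \<partial>(lborel \<Otimes>\<^sub>M lborel)) =
        (\<integral>\<^sup>+x. \<integral>\<^sup>+y. indicator S x * k (x, y) \<partial>lborel \<partial>lborel)"
      by (subst lborel.nn_integral_fst[symmetric]) auto
    also have "\<dots> = (\<integral>\<^sup>+x. indicator S x * (\<integral>\<^sup>+y. k (x, y) \<partial>lborel) \<partial>lborel)"
      by (subst nn_integral_cmult) auto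
    also have "\<dots> \<le> (\<integral>\<^sup>+x. ennreal K * indicator S x \<partial>lborel)"
      using K by (intro nn_integral_mono) (auto simp: indicator_def)
    also have "\<dots> = ennreal K * emeasure lborel S"
      by (rule nn_integral_cmult_indicator) simp
    finally show ?thesis .
  qed
  have 2: "(\<integral>\<^sup>+z. indicator S (snd z) * k z \<partial>(lborel \<Otimes>\<^sub>M lborel)) \<le> ennreal K * emeasure lborel S"
  proof -
    have "(\<integral>\<^sup>+z. indicator S (snd z) * k z \<partial>(lborel \<Otimes>\<^sub>M lborel)) =
        (\<integral>\<^sup>+y. \<integral>\<^sup>+x. indicator S y * k (x, y) \<partial>lborel \<partial>lborel)"
      by (subst lborel_pair.nn_integral_snd[symmetric]) auto
    also have "\<dots> = (\<integral>\<^sup>+y. indicator S y * (\<integral>\<^sup>+x. k (x, y) \<partial>lborel) \<partial>lborel)"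
      by (subst nn_integral_cmult) auto
    also have "\<dots> \<le> (\<integral>\<^sup>+x. ennreal K * indicator S x \<partial>lborel)"
      using K' by (intro nn_integral_mono) (auto simp: indicator_def)
    also have "\<dots> = ennreal K * emeasure lborel S"
      by (rule nn_integral_cmult_indicator) simp
    finally show ?thesis .
  qed
  have "(\<integral>\<^sup>+z. ennreal (gagliardo_integrand s p w z) \<partial>(lborel \<Otimes>\<^sub>M lborel)) \<le>
     (\<integral>\<^sup>+z. ennreal (M powr p) * (indicator S (fst z) * k z + indicator S (snd z) * k z) \<partial>(lborel \<Otimes>\<^sub>M lborel))"
    by (intro nn_integral_mono le)
  also have "\<dots> = ennreal (M powr p) * ((\<integral>\<^sup>+z. indicator S (fst z) * k z \<partial>(lborel \<Otimes>\<^sub>M lborel))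
      + (\<integral>\<^sup>+z. indicator S (snd z) * k z \<partial>(lborel \<Otimes>\<^sub>M lborel)))"
    by (subst nn_integral_cmult, simp, subst nn_integral_add) auto
  also have "\<dots> \<le> ennreal (M powr p) * (ennreal K * emeasure lborel S + ennreal K * emeasure lborel S)"
    by (intro mult_left_mono add_mono 1 2) auto
  also have "\<dots> < \<infinity>" using fin by (auto simp: ennreal_mult_less_top)
  finally have "(\<integral>\<^sup>+z. ennreal (gagliardo_integrand s p w z) \<partial>lborel) < \<infinity>"
    by (simp add: lborel_prod)
  then show ?thesis by (intro integrableI_bounded) (auto simp: gagliardo_borel)
qed

subsection \<open>Lebesgue null sets\<close>

text \<open>Changing a function on a null set thus changes double integrands only on a null set. The
  proof passes to a measurable null set \<open>N\<close> because \<open>P\<close> itself may fail to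
  be measurable.\<close>

lemma AE_lborel_pair_fst_snd:
  assumes "AE x in (lborel :: 'a::euclidean_space measure). P x"
  shows "AE z in (lborel :: ('a \<times> 'a) measure). P (fst z) \<and> P (snd z)"
proof -
  obtain N where N: "\<And>x. x \<notin> N \<Longrightarrow> P x" "N \<in> null_sets lborel"
    using AE_E3[OF assms] by auto
  have [measurable]: "N \<in> sets borel" using N(2) by (auto simp: null_sets_def)
  have n: "AE x in lborel. x \<notin> N" using N(2) by (rule AE_not_in)
  have "AE z in lborel \<Otimes>\<^sub>M lborel. fst z \<notin> N \<and> snd z \<notin> N"
  proof (rule lborel_pair.AE_pair_measure)
    show "AE x in lborel. AE y in lborel. fst (x, y) \<notin> N \<and> snd (x, y) \<notin> N"
      using n by eventually_elim (use n in auto)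
  qed measurable
  then show ?thesis unfolding lborel_prod by eventually_elim (use N in auto)
qed

lemma borel_measurable_lebesgue_AE_eq:
  fixes f g :: "'a::euclidean_space \<Rightarrow> real"
  assumes "AE x in lborel. f x = g x" and g: "g \<in> borel_measurable borel"
  shows "f \<in> borel_measurable lebesgue"
proof (rule measurableI)
  fix A :: "real set" assume A: "A \<in> sets borel"
  show "f -` A \<inter> space lebesgue \<in> sets lebesgue"
  proof (rule completion.in_sets_AE)
    show "AE x in lebesgue. (x \<in> g -` A) = (x \<in> f -` A \<inter> space lebesgue)"
      using AE_completion[OF assms(1)] by eventually_elim auto
    show "g -` A \<in> sets lebesgue"
      using measurable_sets[OF g A] by (intro sets_completionI_sets) auto
  qed auto
qed auto

text \<open>A bridge between the notions of the theorem, which refer to \<open>lebesgue\<close>, and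
  the estimates, which are proved for \<open>lborel\<close> and Borel functions.\<close>

lemma integral_lebesgue_eq_lborel:
  fixes f g :: "'a::euclidean_space \<Rightarrow> real"
  assumes "AE x in lborel. f x = g x" and g: "g \<in> borel_measurable borel"
  shows "(LINT x|lebesgue. f x) = (LINT x|lborel. g x)"
proof -
  have "(LINT x|lebesgue. f x) = (LINT x|lebesgue. g x)"
    using g by (intro integral_cong_AE AE_completion assms borel_measurable_lebesgue_AE_eq[OF assms]
        measurable_completion) auto
  also have "\<dots> = (LINT x|lborel. g x)" using g by (intro integral_completion) auto
  finally show ?thesis .
qed

lemma integrable_lebesgue_iff_lborel:
  fixes f g :: "'a::euclidean_space \<Rightarrow> real"
  assumes "AE x in lborel. f x = g x" and g: "g \<in> borel_measurable borel"
  shows "integrable lebesgue f \<longleftrightarrow> integrable lborel g"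
proof -
  have "integrable lebesgue f \<longleftrightarrow> integrable lebesgue g"
    using g by (intro integrable_cong_AE AE_completion assms borel_measurable_lebesgue_AE_eq[OF assms]
        measurable_completion) auto
  also have "\<dots> \<longleftrightarrow> integrable lborel g" using g by (intro integrable_completion) auto
  finally show ?thesis .
qed

section \<open>Moduli of continuity, and continuous functions that vanish almost everywhere\<close>

lemma geometric_less:
  fixes q C e :: real
  assumes "0 < q" "q < 1" "e > 0"
  obtains k where "C * q ^ k < e"
proof -
  have "(\<lambda>k. C * q ^ k) \<longlonglongrightarrow> C * 0"
    using assms by (intro tendsto_intros LIMSEQ_realpow_zero) auto
  then have "\<forall>\<^sub>F k in sequentially. C * q ^ k < e"
    using assms by (intro order_tendstoD(2)) auto
  then show ?thesis using that by (meson eventually_sequentially order_refl)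
qed

lemma continuous_of_dyadic_modulus:
  fixes v :: "'a::metric_space \<Rightarrow> real"
  assumes "0 < q" "q < 1"
    and v: "\<And>k x y. dist x y \<le> 1 / 2 ^ k \<Longrightarrow> \<bar>v x - v y\<bar> \<le> C * q ^ k"
  shows "continuous_on UNIV v"
  unfolding continuous_on_iff
proof (intro ballI allI impI)
  fix x :: 'a and e :: real assume e: "e > 0"
  obtain k where k: "C * q ^ k < e" using geometric_less[OF assms(1,2) e] .
  show "\<exists>d>0. \<forall>x'\<in>UNIV. dist x' x < d \<longrightarrow> dist (v x') (v x) < e"
  proof (intro exI conjI ballI impI)
    show "1 / 2 ^ k > (0::real)" by simp
    fix x' assume "dist x' x < 1 / 2 ^ k"
    then show "dist (v x') (v x) < e" using v[of x' x k] k by (simp add: dist_real_def)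
  qed
qed

text \<open>The part of \<open>S\<close> where \<open>u\<close> is nonzero is open and null, and a
  nonempty open set is never negligible.\<close>

lemma continuous_AE_zero_on_open:
  fixes u :: "'a::euclidean_space \<Rightarrow> real"
  assumes u: "continuous_on UNIV u" and "open S" and ae: "AE x in lborel. x \<in> S \<longrightarrow> u x = 0" and "x \<in> S"
  shows "u x = 0"
proof (rule ccontr)
  assume "u x \<noteq> 0"
  define U where "U = S \<inter> {x. u x \<noteq> 0}"
  have U: "open U" unfolding U_def
    using \<open>open S\<close> u by (intro open_Int open_Collect_neq) auto
  have "AE x in lborel. x \<notin> U" using ae by eventually_elim (auto simp: U_def)
  then have "U \<in> null_sets lborel"
    using U AE_iff_null_sets[of U lborel] by auto
  then have "negligible U"
    unfolding negligible_iff_null_sets by (rule null_sets_completionI)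
  then show False using open_not_negligible[OF U] \<open>u x \<noteq> 0\<close> \<open>x \<in> S\<close> by (auto simp: U_def)
qed

subsection \<open>Continuous representatives\<close>

locale frac_space =
  fixes \<Omega> :: "'a::euclidean_space set" and s p :: real
  assumes \<Omega>_open: "open \<Omega>" and \<Omega>_bounded: "bounded \<Omega>" and \<Omega>_nonempty: "\<Omega> \<noteq> {}"
    and s0: "0 < s" and s1: "s < 1" and ps: "p * s > real DIM('a)"
begin

lemma p_gt_1: "p > 1"
proof (rule ccontr)
  assume "\<not> p > 1"
  then have "p * s \<le> 1 * s" using s0 by (intro mult_right_mono) auto
  moreover have "real DIM('a) \<ge> 1" using DIM_positive[where 'a='a] by linarith
  ultimately show False using ps s1 by linarith
qed

text \<open>Continuous representatives of the elements of \<open>X0 s p \<Omega>\<close>. Vanishing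
  is asked almost everywhere, as in \<open>X0\<close>; continuity upgrades it to every point off
  \<open>closure \<Omega>\<close>, and this makes \<open>|u| powr p\<close> integrable, see
  \<open>W_integrable_powr\<close>.\<close>

definition W :: "('a \<Rightarrow> real) set" where
  "W = {u. continuous_on UNIV u \<and> (AE x in lborel. x \<notin> \<Omega> \<longrightarrow> u x = 0) \<and>
       integrable lborel (gagliardo_integrand s p u)}"

definition G :: "('a \<Rightarrow> real) \<Rightarrow> real" where
  "G u = (LINT z|lborel. gagliardo_integrand s p u z)"

lemma G_nonneg [simp]: "G u \<ge> 0"
  unfolding G_def by simp

lemma W_borel: "u \<in> W \<Longrightarrow> u \<in> borel_measurable borel"
  unfolding W_def using borel_measurable_continuous_onI by blast

lemma W_integrable: "u \<in> W \<Longrightarrow> integrable lborel (gagliardo_integrand s p u)"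
  unfolding W_def by simp

lemma W_zero_outside:
  assumes "u \<in> W" "x \<notin> closure \<Omega>"
  shows "u x = 0"
proof (rule continuous_AE_zero_on_open[of u "- closure \<Omega>"])
  have "AE x in lborel. x \<notin> \<Omega> \<longrightarrow> u x = 0" using assms by (simp add: W_def)
  then show "AE x in lborel. x \<in> - closure \<Omega> \<longrightarrow> u x = 0"
    by eventually_elim (use closure_subset in auto)
qed (use assms in \<open>auto simp: W_def\<close>)

lemma integrable_of_continuous_zero_outside:
  fixes f :: "'a \<Rightarrow> real"
  assumes "continuous_on UNIV f" "\<And>x. x \<notin> closure \<Omega> \<Longrightarrow> f x = 0"
  shows "integrable lborel f"
proof -
  have "compact (closure \<Omega>)" using \<Omega>_bounded by (simp add: compact_closure)
  then have "set_integrable lborel (closure \<Omega>) f"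
    unfolding set_integrable_def
    by (rule borel_integrable_compact) (rule continuous_on_subset[OF assms(1) subset_UNIV])
  moreover have "(\<lambda>x. indicator (closure \<Omega>) x *\<^sub>R f x) = f"
    using assms by (intro ext) (auto simp: indicator_def)
  ultimately show ?thesis by (simp only: set_integrable_def)
qed

lemma W_integrable_powr:
  assumes "u \<in> W"
  shows "integrable lborel (\<lambda>x. \<bar>u x\<bar> powr p)"
proof (rule integrable_of_continuous_zero_outside)
  show "continuous_on UNIV (\<lambda>x. \<bar>u x\<bar> powr p)"
    using assms p_gt_1 by (intro continuous_on_powr' continuous_intros) (auto simp: W_def)
qed (use W_zero_outside[OF assms] in auto)

lemma W_subset_X0:
  assumes "u \<in> W"
  shows "u \<in> X0 s p \<Omega>"
proof -
  note b = W_borel[OF assms]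
  have "u \<in> borel_measurable lebesgue" using b by (intro measurable_completion) auto
  moreover have "integrable lebesgue (\<lambda>x. \<bar>u x\<bar> powr p)"
    using W_integrable_powr[OF assms] b by (subst integrable_completion) auto
  moreover have "integrable lebesgue (gagliardo_integrand s p u)"
    using W_integrable[OF assms] gagliardo_borel[OF b] by (subst integrable_completion) auto
  moreover have "AE x in lebesgue. x \<notin> \<Omega> \<longrightarrow> u x = 0"
    using assms by (intro AE_completion) (simp add: W_def)
  ultimately show ?thesis by (simp add: X0_def frac_sobolev_def)
qed

lemma X0_norm_W: "u \<in> W \<Longrightarrow> X0_norm s p u = G u powr (1 / p)"
  unfolding X0_norm_def G_def
  by (subst integral_completion) (auto simp: gagliardo_borel W_borel)

text \<open>An element of \<open>X0\<close> is replaced twice, by a Borel function and then by the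
  continuous function from \<open>morrey\<close>. If \<open>u\<close> is already in
  \<open>W\<close>, that function is continuous and agrees with \<open>u\<close> almost everywhere,
  hence is \<open>u\<close> itself, so the bounds hold for \<open>u\<close> at every point.\<close>

lemma morrey_X0:
  obtains C q where "C > 0" "0 < q" "q < 1"
    "\<And>u. u \<in> X0 s p \<Omega> \<Longrightarrow> \<exists>v\<in>W. AE x in lborel. u x = v x"
    "\<And>u H x. \<lbrakk>u \<in> W; H > 0; G u \<le> H powr p\<rbrakk> \<Longrightarrow> \<bar>u x\<bar> \<le> C * H"
    "\<And>u H k x y. \<lbrakk>u \<in> W; H > 0; G u \<le> H powr p; dist x y \<le> 1 / 2 ^ k\<rbrakk> \<Longrightarrow> \<bar>u x - u y\<bar> \<le> C * q ^ k * H"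
proof -
  obtain R where R: "R > 0" "\<And>x. x \<in> \<Omega> \<Longrightarrow> norm x \<le> R"
    using \<Omega>_bounded unfolding bounded_pos by blast
  show ?thesis
  proof (rule morrey[OF p_gt_1 s0 ps R(1)])
    fix C q :: real
    assume Cq: "C > 0" "0 < q" "q < 1" and
      M: "\<And>u :: 'a \<Rightarrow> real. \<lbrakk>u \<in> borel_measurable borel; integrable lborel (\<lambda>x. \<bar>u x\<bar> powr p);
         integrable lborel (gagliardo_integrand s p u); AE x in lborel. norm x > R \<longrightarrow> u x = 0\<rbrakk> \<Longrightarrow>
         \<exists>v. (AE x in lborel. u x = v x) \<and>
             (\<forall>H>0. (LINT z|lborel. gagliardo_integrand s p u z) \<le> H powr p \<longrightarrow>
                (\<forall>x. \<bar>v x\<bar> \<le> C * H) \<and>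
                (\<forall>k x y. dist x y \<le> 1 / 2 ^ k \<longrightarrow> \<bar>v x - v y\<bar> \<le> C * q ^ k * H))"
    have cont: "continuous_on UNIV v"
      if H: "H > 0" and v: "\<forall>k x y. dist x y \<le> 1 / 2 ^ k \<longrightarrow> \<bar>v x - v y\<bar> \<le> C * q ^ k * H"
      for v :: "'a \<Rightarrow> real" and H :: real
      using Cq(2,3) v by (intro continuous_of_dyadic_modulus[where q = q and C = "C * H"]) (auto simp: mult_ac)
    have cover: "AE x in lborel. norm x > R \<longrightarrow> u x = 0"
      if "AE x in lborel. x \<notin> \<Omega> \<longrightarrow> u x = 0" for u :: "'a \<Rightarrow> real"
      using that by eventually_elim (use R(2) in force)
    \<comment> \<open>The modulus in \<open>morrey\<close> is conditional on \<open>H\<close>;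
      continuity of \<open>v\<close> needs one admissible \<open>H\<close> to exist.\<close>
    have ex_pos: "\<exists>H>0. x \<le> H powr p" for x :: real
    proof (intro exI conjI)
      show "max x 1 powr (1 / p) > 0" by simp
      show "x \<le> (max x 1 powr (1 / p)) powr p" using p_gt_1 by (simp add: powr_powr)
    qed
    show ?thesis
    proof (rule that[OF Cq])
      fix u assume "u \<in> X0 s p \<Omega>"
      then have um: "u \<in> borel_measurable lebesgue" and up: "integrable lebesgue (\<lambda>x. \<bar>u x\<bar> powr p)"
        and ug: "integrable lebesgue (gagliardo_integrand s p u)" and "AE x in lebesgue. x \<notin> \<Omega> \<longrightarrow> u x = 0"
        by (auto simp: X0_def frac_sobolev_def)
      then have u0: "AE x in lborel. x \<notin> \<Omega> \<longrightarrow> u x = 0" by (simp add: AE_completion_iff)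
      obtain u' where u': "u' \<in> borel_measurable borel" "AE x in lborel. u x = u' x"
        using completion_ex_borel_measurable_real[OF um] by auto
      have "AE x in lborel. \<bar>u x\<bar> powr p = \<bar>u' x\<bar> powr p" using u'(2) by eventually_elim auto
      then have up': "integrable lborel (\<lambda>x. \<bar>u' x\<bar> powr p)"
        using u' up by (subst integrable_lebesgue_iff_lborel[symmetric]) auto
      have "AE z in lborel. gagliardo_integrand s p u z = gagliardo_integrand s p u' z"
        using AE_lborel_pair_fst_snd[OF u'(2)]
        by eventually_elim (auto simp: gagliardo_integrand_def split: prod.splits)
      then have ug': "integrable lborel (gagliardo_integrand s p u')"
        using gagliardo_borel[OF u'(1)] ug by (subst integrable_lebesgue_iff_lborel[symmetric])
      have u0': "AE x in lborel. x \<notin> \<Omega> \<longrightarrow> u' x = 0" using u0 u'(2) by eventually_elim auto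
      obtain v where v: "AE x in lborel. u' x = v x"
         "\<forall>H>0. (LINT z|lborel. gagliardo_integrand s p u' z) \<le> H powr p \<longrightarrow>
                (\<forall>x. \<bar>v x\<bar> \<le> C * H) \<and>
                (\<forall>k x y. dist x y \<le> 1 / 2 ^ k \<longrightarrow> \<bar>v x - v y\<bar> \<le> C * q ^ k * H)"
        using M[OF u'(1) up' ug' cover[OF u0']] by blast
      have vc: "continuous_on UNIV v"
        using ex_pos[of "LINT z|lborel. gagliardo_integrand s p u' z"] v(2) cont by blast
      then have vb: "v \<in> borel_measurable borel" by (rule borel_measurable_continuous_onI)
      have "AE z in lborel. gagliardo_integrand s p u' z = gagliardo_integrand s p v z"
        using AE_lborel_pair_fst_snd[OF v(1)]
        by eventually_elim (auto simp: gagliardo_integrand_def split: prod.splits)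
      then have "integrable lborel (gagliardo_integrand s p v)"
        using ug' gagliardo_borel[OF u'(1)] gagliardo_borel[OF vb]
        by (subst integrable_cong_AE[symmetric]) auto
      moreover have "AE x in lborel. x \<notin> \<Omega> \<longrightarrow> v x = 0" using u0' v(1) by eventually_elim auto
      moreover have "AE x in lborel. u x = v x" using u'(2) v(1) by eventually_elim auto
      ultimately show "\<exists>v\<in>W. AE x in lborel. u x = v x" using vc by (auto simp: W_def)
    next
      have eq: "(\<forall>x. \<bar>u x\<bar> \<le> C * H) \<and> (\<forall>k x y. dist x y \<le> 1 / 2 ^ k \<longrightarrow> \<bar>u x - u y\<bar> \<le> C * q ^ k * H)"
        if u: "u \<in> W" and H: "H > 0" "G u \<le> H powr p" for u and H :: real
      proof -
        have u0: "AE x in lborel. x \<notin> \<Omega> \<longrightarrow> u x = 0" using u by (simp add: W_def)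
        obtain v where v: "AE x in lborel. u x = v x"
          "(\<forall>x. \<bar>v x\<bar> \<le> C * H) \<and> (\<forall>k x y. dist x y \<le> 1 / 2 ^ k \<longrightarrow> \<bar>v x - v y\<bar> \<le> C * q ^ k * H)"
          using M[OF W_borel[OF u] W_integrable_powr[OF u] W_integrable[OF u] cover[OF u0]] H
          unfolding G_def by blast
        have "continuous_on UNIV v" using cont[OF H(1)] v(2) by blast
        then have "continuous_on UNIV (\<lambda>x. u x - v x)"
          using u by (intro continuous_intros) (auto simp: W_def)
        moreover have "AE x in lborel. x \<in> UNIV \<longrightarrow> u x - v x = 0" using v(1) by eventually_elim auto
        ultimately have "u x - v x = 0" for x
          using continuous_AE_zero_on_open[of "\<lambda>x. u x - v x" UNIV x] by simp
        then have "u = v" by (intro ext) simp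
        then show ?thesis using v(2) by simp
      qed
      show "\<bar>u x\<bar> \<le> C * H" if "u \<in> W" "H > 0" "G u \<le> H powr p" for u x and H :: real
        using eq[OF that] by blast
      show "\<bar>u x - u y\<bar> \<le> C * q ^ k * H"
        if "u \<in> W" "H > 0" "G u \<le> H powr p" "dist x y \<le> 1 / 2 ^ k" for u x y k and H :: real
        using eq[OF that(1-3)] that(4) by blast
    qed
  qed
qed

end

subsection \<open>Passing to the limit and differentiating under the integral\<close>

text \<open>The finite limit of the integrals yields integrability of \<open>g\<close> as well; this
  is what puts the limit of a minimising sequence into \<open>W\<close>.\<close>

lemma fatou_real:
  fixes f :: "nat \<Rightarrow> 'b \<Rightarrow> real"
  assumes f: "\<And>n. integrable M (f n)" "\<And>n z. f n z \<ge> 0" and g: "\<And>z. (\<lambda>n. f n z) \<longlonglongrightarrow> g z"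
    and l: "(\<lambda>n. LINT z|M. f n z) \<longlonglongrightarrow> l"
  shows "integrable M g" "(LINT z|M. g z) \<le> l"
proof -
  have [measurable]: "f n \<in> borel_measurable M" for n using f(1) by auto
  have gm [measurable]: "g \<in> borel_measurable M"
    by (rule borel_measurable_LIMSEQ_real[OF g]) auto
  have g0: "g z \<ge> 0" for z using g[of z] f(2) by (intro LIMSEQ_le_const) auto
  have l0: "l \<ge> 0" using l f(2) by (intro LIMSEQ_le_const[OF l]) auto
  have "(\<integral>\<^sup>+z. ennreal (g z) \<partial>M) = (\<integral>\<^sup>+z. liminf (\<lambda>n. ennreal (f n z)) \<partial>M)"
    by (intro nn_integral_cong lim_imp_Liminf[symmetric] tendsto_ennrealI g) simp
  also have "\<dots> \<le> liminf (\<lambda>n. \<integral>\<^sup>+z. ennreal (f n z) \<partial>M)"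
    by (intro nn_integral_liminf) auto
  also have "(\<lambda>n. \<integral>\<^sup>+z. ennreal (f n z) \<partial>M) = (\<lambda>n. ennreal (LINT z|M. f n z))"
    using f by (intro ext nn_integral_eq_integral) auto
  also have "liminf \<dots> = ennreal l"
    using l by (intro lim_imp_Liminf tendsto_ennrealI) auto
  finally have le: "(\<integral>\<^sup>+z. ennreal (g z) \<partial>M) \<le> ennreal l" .
  show int: "integrable M g"
  proof (rule integrableI_nonneg)
    show "(\<integral>\<^sup>+z. ennreal (g z) \<partial>M) < \<infinity>"
      using le by (simp add: order_le_less_trans)
  qed (use g0 in auto)
  have "ennreal (LINT z|M. g z) \<le> ennreal l"
    using le nn_integral_eq_integral[OF int] g0 by simp
  then show "(LINT z|M. g z) \<le> l" using l0 by simp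
qed

text \<open>Dominated convergence for the difference quotients. It works along sequences, hence the
  detour through sequential limits; a shift of the sequence removes the terms of modulus above 1,
  about which \<open>bound\<close> says nothing.\<close>

lemma DERIV_integral:
  fixes h :: "real \<Rightarrow> 'b \<Rightarrow> real"
  assumes int: "\<And>t. integrable M (h t)" and d: "d \<in> borel_measurable M"
    and deriv: "\<And>z. ((\<lambda>t. h t z) has_real_derivative d z) (at 0)"
    and w: "integrable M w"
    and bound: "\<And>t. \<bar>t\<bar> \<le> 1 \<Longrightarrow> AE z in M. \<bar>h t z - h 0 z\<bar> \<le> \<bar>t\<bar> * w z"
  shows "integrable M d" "((\<lambda>t. LINT z|M. h t z) has_real_derivative (LINT z|M. d z)) (at 0)"
proof -
  have key: "integrable M d \<and> (\<lambda>n. ((LINT z|M. h (X n) z) - (LINT z|M. h 0 z)) / X n) \<longlonglongrightarrow> (LINT z|M. d z)"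
    if X: "\<And>n. X n \<noteq> 0" "\<And>n. \<bar>X n\<bar> \<le> 1" "X \<longlonglongrightarrow> 0" for X :: "nat \<Rightarrow> real"
  proof -
    define s where "s n z = (h (X n) z - h 0 z) / X n" for n z
    have 1: "AE z in M. (\<lambda>n. s n z) \<longlonglongrightarrow> d z"
    proof (rule AE_I2)
      fix z
      have "((\<lambda>t. (h t z - h 0 z) / (t - 0)) \<longlongrightarrow> d z) (at 0)"
        using deriv[of z] by (simp add: has_field_derivative_iff)
      moreover have "filterlim X (at 0) sequentially"
        using X by (simp add: filterlim_at)
      ultimately show "(\<lambda>n. s n z) \<longlonglongrightarrow> d z"
        unfolding s_def using filterlim_compose by fastforce
    qed
    have 2: "s n \<in> borel_measurable M" for n
    proof -
      have "h t \<in> borel_measurable M" for t using int[of t] by auto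
      note [measurable] = this
      show ?thesis unfolding s_def by measurable
    qed
    have 3: "AE z in M. norm (s n z) \<le> w z" for n
      using bound[OF X(2)[of n]]
      by eventually_elim (use X(1)[of n] in \<open>simp add: s_def field_simps abs_mult\<close>)
    have "(LINT z|M. s n z) = ((LINT z|M. h (X n) z) - (LINT z|M. h 0 z)) / X n" for n
      unfolding s_def using int by simp
    then show ?thesis
      using integral_dominated_convergence[OF d 2 w 1 3]
        integrable_dominated_convergence[OF d 2 w 1 3] by simp
  qed
  show "integrable M d"
  proof -
    have "(\<lambda>n. inverse (real (Suc n))) \<longlonglongrightarrow> 0" by (rule LIMSEQ_inverse_real_of_nat)
    moreover have "\<bar>inverse (real (Suc n))\<bar> \<le> 1" for n
      by (simp add: inverse_le_1_iff)
    ultimately show ?thesis using key[of "\<lambda>n. inverse (real (Suc n))"] by simp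
  qed
  show "((\<lambda>t. LINT z|M. h t z) has_real_derivative (LINT z|M. d z)) (at 0)"
    unfolding has_field_derivative_iff tendsto_at_iff_sequentially comp_def
  proof (intro allI impI)
    fix X :: "nat \<Rightarrow> real"
    assume X: "\<forall>i. X i \<in> UNIV - {0}" and X0: "X \<longlonglongrightarrow> 0"
    have "\<forall>\<^sub>F n in sequentially. \<bar>X n\<bar> < 1"
      using tendsto_rabs[OF X0] by (intro order_tendstoD(2)) auto
    then obtain N where N: "\<And>n. n \<ge> N \<Longrightarrow> \<bar>X n\<bar> < 1" unfolding eventually_sequentially by blast
    have "(\<lambda>n. ((LINT z|M. h (X (n + N)) z) - (LINT z|M. h 0 z)) / X (n + N)) \<longlonglongrightarrow> (LINT z|M. d z)"
      using X N by (intro key[THEN conjunct2] LIMSEQ_ignore_initial_segment X0) (auto simp: less_imp_le)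
    then show "(\<lambda>n. ((LINT z|M. h (X n) z) - (LINT z|M. h 0 z)) / (X n - 0)) \<longlonglongrightarrow> (LINT z|M. d z)"
      using LIMSEQ_offset[of "\<lambda>n. ((LINT z|M. h (X n) z) - (LINT z|M. h 0 z)) / X n" N] by simp
  qed
qed

text \<open>At 0 the difference quotient has modulus \<open>|h| powr (p - 1)\<close>, which tends to
  0 since \<open>p > 1\<close>; the formula also gives 0 there, thanks to the factor
  \<open>x\<close>.\<close>

lemma abs_powr_deriv:
  fixes p x :: real
  assumes "p > 1"
  shows "((\<lambda>x. \<bar>x\<bar> powr p) has_real_derivative p * (\<bar>x\<bar> powr (p - 2) * x)) (at x)"
proof -
  consider "x > 0" | "x < 0" | "x = 0" by linarith
  then show ?thesis
  proof cases
    case 1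
    have "((\<lambda>x. x powr p) has_real_derivative p * x powr (p - 1)) (at x)"
      using 1 by (rule has_real_derivative_powr)
    then have "((\<lambda>x. \<bar>x\<bar> powr p) has_real_derivative p * x powr (p - 1)) (at x)"
    proof (rule has_field_derivative_transform_within_open[where S = "{0<..}"])
    qed (use 1 in auto)
    moreover have "x powr (p - 1) = \<bar>x\<bar> powr (p - 2) * x"
      using 1 powr_add[of x "p - 2" 1] by simp
    ultimately show ?thesis by simp
  next
    case 2
    have "((\<lambda>x. (- x) powr p) has_real_derivative p * (- x) powr (p - 1) * (-1)) (at x)"
      using 2 by (auto intro!: derivative_eq_intros DERIV_chain2[OF has_real_derivative_powr])
    then have "((\<lambda>x. \<bar>x\<bar> powr p) has_real_derivative p * (- x) powr (p - 1) * (-1)) (at x)"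
    proof (rule has_field_derivative_transform_within_open[where S = "{..<0}"])
    qed (use 2 in auto)
    moreover have "(- x) powr (p - 1) * (-1) = \<bar>x\<bar> powr (p - 2) * x"
      using 2 powr_add[of "- x" "p - 2" 1] by simp
    ultimately show ?thesis by (simp only: mult.assoc)
  next
    case 3
    have "((\<lambda>h. \<bar>h\<bar> powr (p - 1)) \<longlongrightarrow> 0) (at (0::real))"
      using tendsto_powr'[of "\<lambda>h. \<bar>h\<bar>" "0::real" "at 0" "\<lambda>_. p - 1" "p - 1"] assms
      by (simp add: tendsto_rabs_zero)
    moreover have "\<bar>\<bar>h\<bar> powr p / h\<bar> = \<bar>h\<bar> powr (p - 1)" if "h \<noteq> 0" for h :: real
      using that by (simp add: powr_diff)
    ultimately have "((\<lambda>h. \<bar>\<bar>h\<bar> powr p / h\<bar>) \<longlongrightarrow> 0) (at (0::real))"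
      by (subst tendsto_cong[where g = "\<lambda>h. \<bar>h\<bar> powr (p - 1)"]) (auto simp: eventually_at_filter)
    then have "((\<lambda>h. \<bar>h\<bar> powr p / h) \<longlongrightarrow> 0) (at (0::real))"
      by (rule tendsto_rabs_zero_cancel)
    then show ?thesis using 3 by (simp add: has_field_derivative_iff)
  qed
qed

lemma powr_add_le:
  fixes a b p :: real
  assumes "p > 0" "a \<ge> 0" "b \<ge> 0"
  shows "(a + b) powr p \<le> 2 powr p * (a powr p + b powr p)"
proof -
  have "(a + b) powr p \<le> (2 * max a b) powr p" using assms by (intro powr_mono2) auto
  also have "\<dots> = 2 powr p * max a b powr p" using assms by (simp add: powr_mult)
  also have "\<dots> \<le> 2 powr p * (a powr p + b powr p)"
    by (intro mult_left_mono) (auto simp: max_def)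
  finally show ?thesis .
qed

text \<open>The mean value inequality in \<open>t\<close> on \<open>[-1, 1]\<close>: the derivative
  is at most \<open>p * (|a| + |b|) powr p\<close>. Divided by the denominator of the Gagliardo
  quotient, this is the dominating function in \<open>DERIV_G\<close>.\<close>

lemma abs_powr_increment_le:
  fixes a b p t :: real
  assumes p: "p > 1" and t: "\<bar>t\<bar> \<le> 1"
  shows "\<bar>\<bar>a + t * b\<bar> powr p - \<bar>a\<bar> powr p\<bar> \<le> \<bar>t\<bar> * (p * 2 powr p * (\<bar>a\<bar> powr p + \<bar>b\<bar> powr p))"
proof -
  define B where "B = p * 2 powr p * (\<bar>a\<bar> powr p + \<bar>b\<bar> powr p)"
  have "norm (\<bar>a + t * b\<bar> powr p - \<bar>a + 0 * b\<bar> powr p) \<le> B * norm (t - 0)"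
  proof (rule field_differentiable_bound[where S = "{-1..1}" and f = "\<lambda>t. \<bar>a + t * b\<bar> powr p"
        and f' = "\<lambda>t. p * (\<bar>a + t * b\<bar> powr (p - 2) * (a + t * b)) * b"])
    fix x :: real assume x: "x \<in> {-1..1}"
    show "((\<lambda>t. \<bar>a + t * b\<bar> powr p) has_real_derivative
        p * (\<bar>a + x * b\<bar> powr (p - 2) * (a + x * b)) * b) (at x within {-1..1})"
      by (rule has_field_derivative_at_within, rule DERIV_chain2[OF abs_powr_deriv[OF p]])
         (auto intro!: derivative_eq_intros)
    define c where "c = a + x * b"
    have "\<bar>x * b\<bar> \<le> 1 * \<bar>b\<bar>" unfolding abs_mult using x by (intro mult_right_mono) auto
    then have c: "\<bar>c\<bar> \<le> \<bar>a\<bar> + \<bar>b\<bar>" unfolding c_def by linarith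
    have "\<bar>\<bar>c\<bar> powr (p - 2) * c\<bar> = \<bar>c\<bar> powr (p - 1)"
      using powr_add[of "\<bar>c\<bar>" "p - 2" 1] by (cases "c = 0") (auto simp: abs_mult)
    also have "\<dots> \<le> (\<bar>a\<bar> + \<bar>b\<bar>) powr (p - 1)" using c p by (intro powr_mono2) auto
    finally have "\<bar>\<bar>c\<bar> powr (p - 2) * c\<bar> * \<bar>b\<bar> \<le> (\<bar>a\<bar> + \<bar>b\<bar>) powr (p - 1) * (\<bar>a\<bar> + \<bar>b\<bar>)"
      by (intro mult_mono) auto
    also have "\<dots> = (\<bar>a\<bar> + \<bar>b\<bar>) powr p"
      using powr_add[of "\<bar>a\<bar> + \<bar>b\<bar>" "p - 1" 1] by (cases "\<bar>a\<bar> + \<bar>b\<bar> = 0") auto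
    also have "\<dots> \<le> 2 powr p * (\<bar>a\<bar> powr p + \<bar>b\<bar> powr p)" using p by (intro powr_add_le) auto
    finally show "norm (p * (\<bar>a + x * b\<bar> powr (p - 2) * (a + x * b)) * b) \<le> B"
      using p unfolding B_def c_def[symmetric] by (simp add: abs_mult mult.assoc)
  qed (use t in auto)
  then show ?thesis by (simp add: B_def mult.commute)
qed

section \<open>Operations on the continuous representatives, and a cutoff function\<close>

context frac_space
begin

lemma zero_in_W: "(\<lambda>_. 0) \<in> W"
  by (simp add: W_def gagliardo_integrand_def split_def)

lemma G_zero: "G (\<lambda>_. 0) = 0"
  by (simp add: G_def gagliardo_integrand_def split_def)

lemma gagliardo_add_le:
  fixes u v :: "'a \<Rightarrow> real"
  shows "gagliardo_integrand s p (\<lambda>x. u x + t * v x) z \<le>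
     2 powr p * (gagliardo_integrand s p u z + \<bar>t\<bar> powr p * gagliardo_integrand s p v z)"
proof (cases z)
  case (Pair x y)
  have "\<bar>(u x + t * v x) - (u y + t * v y)\<bar> \<le> \<bar>u x - u y\<bar> + \<bar>t\<bar> * \<bar>v x - v y\<bar>"
    by (simp add: abs_mult[symmetric] algebra_simps)
  then have "\<bar>(u x + t * v x) - (u y + t * v y)\<bar> powr p \<le> (\<bar>u x - u y\<bar> + \<bar>t\<bar> * \<bar>v x - v y\<bar>) powr p"
    using p_gt_1 by (intro powr_mono2) auto
  also have "\<dots> \<le> 2 powr p * (\<bar>u x - u y\<bar> powr p + (\<bar>t\<bar> * \<bar>v x - v y\<bar>) powr p)"
    using p_gt_1 by (intro powr_add_le) auto
  finally have "\<bar>(u x + t * v x) - (u y + t * v y)\<bar> powr p \<le>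
      2 powr p * (\<bar>u x - u y\<bar> powr p + \<bar>t\<bar> powr p * \<bar>v x - v y\<bar> powr p)"
    by (simp add: powr_mult)
  then have "\<bar>(u x + t * v x) - (u y + t * v y)\<bar> powr p / norm (x - y) powr (real DIM('a) + p * s) \<le>
      2 powr p * (\<bar>u x - u y\<bar> powr p + \<bar>t\<bar> powr p * \<bar>v x - v y\<bar> powr p) / norm (x - y) powr (real DIM('a) + p * s)"
    by (intro divide_right_mono) auto
  then show ?thesis by (simp add: Pair gagliardo_integrand_def add_divide_distrib distrib_left)
qed

lemma W_add_scaled:
  assumes "u \<in> W" "v \<in> W"
  shows "(\<lambda>x. u x + t * v x) \<in> W"
proof -
  have c: "continuous_on UNIV (\<lambda>x. u x + t * v x)"
    using assms by (auto simp: W_def intro!: continuous_intros)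
  have "AE x in lborel. x \<notin> \<Omega> \<longrightarrow> u x = 0" "AE x in lborel. x \<notin> \<Omega> \<longrightarrow> v x = 0"
    using assms by (auto simp: W_def)
  then have z: "AE x in lborel. x \<notin> \<Omega> \<longrightarrow> u x + t * v x = 0" by eventually_elim auto
  have "integrable lborel (\<lambda>z. 2 powr p * (gagliardo_integrand s p u z + \<bar>t\<bar> powr p * gagliardo_integrand s p v z))"
    using assms W_integrable by (intro integrable_mult_right Bochner_Integration.integrable_add) auto
  then have "integrable lborel (gagliardo_integrand s p (\<lambda>x. u x + t * v x))"
  proof (rule Bochner_Integration.integrable_bound)
    show "gagliardo_integrand s p (\<lambda>x. u x + t * v x) \<in> borel_measurable lborel"
      using gagliardo_borel[OF borel_measurable_continuous_onI[OF c]] by simp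
    show "AE z in lborel. norm (gagliardo_integrand s p (\<lambda>x. u x + t * v x) z) \<le>
       norm (2 powr p * (gagliardo_integrand s p u z + \<bar>t\<bar> powr p * gagliardo_integrand s p v z))"
      using gagliardo_add_le by (intro AE_I2) (auto simp: abs_mult)
  qed
  with c z show ?thesis by (simp add: W_def)
qed

lemma W_scaled:
  assumes "v \<in> W"
  shows "(\<lambda>x. t * v x) \<in> W" "G (\<lambda>x. t * v x) = \<bar>t\<bar> powr p * G v"
proof -
  show "(\<lambda>x. t * v x) \<in> W" using W_add_scaled[OF zero_in_W assms, of t] by simp
  have "gagliardo_integrand s p (\<lambda>x. t * v x) z = \<bar>t\<bar> powr p * gagliardo_integrand s p v z" for z
    by (auto simp: gagliardo_integrand_def powr_mult abs_mult split_def simp flip: right_diff_distrib)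
  then show "G (\<lambda>x. t * v x) = \<bar>t\<bar> powr p * G v" by (simp add: G_def)
qed

text \<open>Truncation at 0 does not increase differences, so the inequality holds pointwise for the
  integrands.\<close>

lemma W_pos_part:
  assumes "u \<in> W"
  shows "(\<lambda>x. max 0 (u x)) \<in> W" "G (\<lambda>x. max 0 (u x)) \<le> G u"
proof -
  have c: "continuous_on UNIV (\<lambda>x. max 0 (u x))"
    using assms by (auto simp: W_def intro!: continuous_intros)
  have "AE x in lborel. x \<notin> \<Omega> \<longrightarrow> u x = 0" using assms by (auto simp: W_def)
  then have z: "AE x in lborel. x \<notin> \<Omega> \<longrightarrow> max 0 (u x) = 0" by eventually_elim auto
  have le: "gagliardo_integrand s p (\<lambda>x. max 0 (u x)) z \<le> gagliardo_integrand s p u z" for z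
    using p_gt_1 by (auto simp: gagliardo_integrand_def split_def intro!: divide_right_mono powr_mono2)
  have int: "integrable lborel (gagliardo_integrand s p (\<lambda>x. max 0 (u x)))"
    using W_integrable[OF assms]
  proof (rule Bochner_Integration.integrable_bound)
    show "gagliardo_integrand s p (\<lambda>x. max 0 (u x)) \<in> borel_measurable lborel"
      using gagliardo_borel[OF borel_measurable_continuous_onI[OF c]] by simp
  qed (use le in auto)
  with c z show "(\<lambda>x. max 0 (u x)) \<in> W" by (simp add: W_def)
  show "G (\<lambda>x. max 0 (u x)) \<le> G u"
    unfolding G_def using W_integrable[OF assms] int le by (intro integral_mono) auto
qed

text \<open>A tent function: with \<open>ball x0 (2 * r)\<close> inside \<Omega>, it is 1 on
  \<open>ball x0 r\<close>, 0 outside the larger ball and linear in the distance to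
  \<open>x0\<close> in between, hence Lipschitz.\<close>

lemma cutoff_in_W:
  obtains w K where "w \<in> W" "\<And>x. 0 \<le> w x" "K \<subseteq> \<Omega>" "open K" "K \<noteq> {}" "\<And>x. x \<in> K \<Longrightarrow> w x = 1"
proof -
  obtain x0 where x0: "x0 \<in> \<Omega>" using \<Omega>_nonempty by blast
  obtain r where r: "r > 0" "ball x0 (2 * r) \<subseteq> \<Omega>"
  proof -
    obtain e where "e > 0" "ball x0 e \<subseteq> \<Omega>" using \<Omega>_open x0 open_contains_ball by blast
    then show ?thesis by (intro that[of "e / 2"]) auto
  qed
  define w where "w x = max 0 (min 1 (2 - dist x0 x / r))" for x
  have c: "continuous_on UNIV w" unfolding w_def using r by (intro continuous_intros) auto
  have w01: "0 \<le> w x" "w x \<le> 1" for x by (auto simp: w_def)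
  have zero: "w x = 0" if "x \<notin> ball x0 (2 * r)" for x
    using that r by (auto simp: w_def field_simps)
  have "integrable lborel (gagliardo_integrand s p w)"
  proof (rule gagliardo_integrable_of_lipschitz)
    fix x y :: 'a
    have "\<bar>dist x0 x / r - dist x0 y / r\<bar> \<le> norm (x - y) / r"
      using r dist_triangle[of x0 x y] dist_triangle[of x0 y x]
      by (auto simp: dist_norm norm_minus_commute diff_divide_distrib[symmetric] abs_divide intro!: divide_right_mono)
    then have a: "\<bar>w x - w y\<bar> \<le> norm (x - y) / r" unfolding w_def by linarith
    have b: "\<bar>w x - w y\<bar> \<le> 1" using w01[of x] w01[of y] by linarith
    show "\<bar>w x - w y\<bar> \<le> max 1 (1 / r) * min 1 (norm (x - y))"
    proof (cases "norm (x - y) \<le> 1")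
      case True
      have "norm (x - y) / r \<le> max 1 (1 / r) * norm (x - y)"
        using mult_right_mono[of "1 / r" "max 1 (1 / r)" "norm (x - y)"] by simp
      then show ?thesis using a True by (simp add: min_def)
    next
      case False
      then show ?thesis using b by (simp add: min_def)
    qed
    show "x \<notin> ball x0 (2 * r) \<Longrightarrow> w x = 0" using zero by blast
  qed (use s0 s1 p_gt_1 borel_measurable_continuous_onI[OF c] in \<open>auto simp: emeasure_ball_less_top\<close>)
  moreover have "AE x in lborel. x \<notin> \<Omega> \<longrightarrow> w x = 0" using zero r by (intro AE_I2) blast
  ultimately have "w \<in> W" using c by (simp add: W_def)
  moreover have "w x = 1" if "x \<in> ball x0 r" for x
    using that r by (auto simp: w_def field_simps)
  moreover have "ball x0 r \<subseteq> \<Omega>" using r subset_ball[of r "2 * r" x0] by auto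
  ultimately show ?thesis using w01 r by (intro that[of w "ball x0 r"]) auto
qed

end

subsection \<open>The energy functional\<close>

text \<open>\<open>m\<close> and \<open>M\<close> are real bounds for \<alpha>, to be extracted from
  the conditions on its essential infimum and supremum.\<close>

locale frac_problem = frac_space +
  fixes \<alpha> :: "'a::euclidean_space \<Rightarrow> real" and f :: "real \<Rightarrow> real" and lam m M :: real
  assumes lam: "lam > 0" and m: "m > 0"
    and \<alpha>_meas: "\<alpha> \<in> borel_measurable (lebesgue_on \<Omega>)"
    and \<alpha>_lower: "AE x in lebesgue_on \<Omega>. m \<le> \<alpha> x"
    and \<alpha>_upper: "AE x in lebesgue_on \<Omega>. \<alpha> x \<le> M"
    and f_cont: "continuous_on UNIV f" and f_nonneg: "\<And>t. f t \<ge> 0"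
begin

abbreviation "\<mu> \<equiv> lebesgue_on \<Omega>"
abbreviation "F \<equiv> primitive f"

lemma DERIV_F: "(F has_real_derivative f t) (at t)"
proof -
  \<comment> \<open>The interval contains 0, where the integral starts, and has \<open>t\<close> in
    its interior, so the derivative within it is the derivative at \<open>t\<close>.\<close>
  define a where "a = min 0 t - 1"
  define b where "b = max 0 t + 1"
  have "((\<lambda>x. LBINT \<zeta>=ereal 0..ereal x. f \<zeta>) has_vector_derivative f t) (at t within {a..b})"
    by (rule interval_integral_FTC2) (auto simp: a_def b_def intro: continuous_on_subset[OF f_cont])
  then have "(F has_vector_derivative f t) (at t within {a..b})"
    unfolding primitive_def[abs_def] by (simp add: zero_ereal_def)
  then show ?thesis
    by (subst (asm) at_within_Icc_at) (auto simp: a_def b_def has_real_derivative_iff_has_vector_derivative)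
qed

lemma F_zero [simp]: "F 0 = 0"
  by (simp add: primitive_def zero_ereal_def[symmetric])

lemma F_mono:
  assumes "x \<le> y"
  shows "F x \<le> F y"
proof (rule DERIV_nonneg_imp_nondecreasing[OF assms])
  show "\<exists>d. (F has_real_derivative d) (at z) \<and> d \<ge> 0" for z
    using DERIV_F[of z] f_nonneg[of z] by (intro exI conjI)
qed

lemma F_nonneg: "x \<ge> 0 \<Longrightarrow> F x \<ge> 0"
  using F_mono[of 0 x] by simp

lemma F_cont: "continuous_on UNIV F"
  by (rule DERIV_continuous_on[OF DERIV_F])

lemma F_increment:
  assumes B: "\<And>t. \<bar>t\<bar> \<le> K \<Longrightarrow> f t \<le> B" and "\<bar>x\<bar> \<le> K" "\<bar>y\<bar> \<le> K"
  shows "\<bar>F x - F y\<bar> \<le> B * \<bar>x - y\<bar>"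
proof -
  have "norm (F x - F y) \<le> B * norm (x - y)"
  proof (rule field_differentiable_bound[where S = "{-K..K}" and f' = f])
    fix z assume z: "z \<in> {-K..K}"
    show "norm (f z) \<le> B" using z B[of z] f_nonneg[of z] by auto
    show "(F has_real_derivative f z) (at z within {-K..K})"
      using DERIV_F by (rule has_field_derivative_at_within)
  qed (use assms in auto)
  then show ?thesis by simp
qed

lemma finite_\<mu>: "finite_measure \<mu>"
  using \<Omega>_open \<Omega>_bounded by (intro finite_measure_lebesgue_on lmeasurable_open)

lemma \<Omega>_lebesgue: "\<Omega> \<in> sets lebesgue"
  using \<Omega>_open by auto

lemma borel_measurable_\<mu>: "g \<in> borel_measurable borel \<Longrightarrow> g \<in> borel_measurable \<mu>" for g :: "'a \<Rightarrow> real"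
  by (intro measurable_restrict_space1 measurable_completion) auto

lemma AE_\<mu>:
  assumes "AE x in lborel. P x"
  shows "AE x in \<mu>. P x"
proof -
  have "AE x in lebesgue. x \<in> \<Omega> \<longrightarrow> P x"
    using AE_completion[OF assms] by eventually_elim simp
  then show ?thesis using \<Omega>_lebesgue by (subst AE_restrict_space_iff) auto
qed

lemma \<alpha>_bounds: "AE x in \<mu>. 0 < \<alpha> x \<and> \<alpha> x \<le> M"
  using \<alpha>_lower \<alpha>_upper by eventually_elim (use m in auto)

lemma integrable_\<alpha>_mult:
  fixes g :: "'a \<Rightarrow> real"
  assumes "g \<in> borel_measurable borel" and g: "\<And>x. \<bar>g x\<bar> \<le> B"
  shows "integrable \<mu> (\<lambda>x. \<alpha> x * g x)"
proof (rule finite_measure.integrable_const_bound[OF finite_\<mu>, where B = "M * B"])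
  show "(\<lambda>x. \<alpha> x * g x) \<in> borel_measurable \<mu>"
    using \<alpha>_meas borel_measurable_\<mu>[OF assms(1)] by (intro borel_measurable_times)
  show "AE x in \<mu>. norm (\<alpha> x * g x) \<le> M * B"
    using \<alpha>_bounds by eventually_elim (use g in \<open>auto simp: abs_mult intro!: mult_mono\<close>)
qed

definition A :: real where "A = (LINT x|\<mu>. \<alpha> x)"

lemma integrable_\<alpha>: "integrable \<mu> \<alpha>"
  using integrable_\<alpha>_mult[of "\<lambda>_. 1" 1] by simp

lemma A_nonneg: "A \<ge> 0"
proof -
  have "AE x in \<mu>. 0 \<le> \<alpha> x" using \<alpha>_bounds by eventually_elim auto
  then show ?thesis unfolding A_def by (rule integral_nonneg_AE)
qed

definition Psi :: "('a \<Rightarrow> real) \<Rightarrow> real" where "Psi u = (LINT x|\<mu>. \<alpha> x * F (u x))"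

definition E :: "('a \<Rightarrow> real) \<Rightarrow> real" where "E u = G u / p - lam * Psi u"

lemma W_bounded:
  assumes "u \<in> W"
  obtains K where "K > 0" "\<And>x. \<bar>u x\<bar> \<le> K"
proof -
  have "compact (u ` closure \<Omega>)"
    using assms \<Omega>_bounded by (intro compact_continuous_image)
      (auto simp: W_def compact_closure intro: continuous_on_subset)
  then obtain K where K: "K > 0" "\<And>y. y \<in> u ` closure \<Omega> \<Longrightarrow> norm y \<le> K"
    using compact_imp_bounded bounded_pos by metis
  have "\<bar>u x\<bar> \<le> K" for x
    using K W_zero_outside[OF assms, of x] by (cases "x \<in> closure \<Omega>") auto
  with K(1) show ?thesis using that by blast
qed

lemma F_bounded:
  assumes "\<bar>x\<bar> \<le> K"
  shows "\<bar>F x\<bar> \<le> max (F K) (- F (- K))"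
  using F_mono[of x K] F_mono[of "- K" x] assms by (auto simp: abs_le_iff)

lemma F_comp_borel: "u \<in> borel_measurable borel \<Longrightarrow> (\<lambda>x. F (u x)) \<in> borel_measurable borel"
  by (rule measurable_compose[OF _ borel_measurable_continuous_onI[OF F_cont]])

lemma Psi_integrable:
  assumes "u \<in> W"
  shows "integrable \<mu> (\<lambda>x. \<alpha> x * F (u x))"
proof -
  obtain K where "\<And>x. \<bar>u x\<bar> \<le> K" using W_bounded[OF assms] by metis
  then show ?thesis
    using F_bounded by (intro integrable_\<alpha>_mult F_comp_borel W_borel[OF assms]) blast
qed

lemma Psi_le:
  assumes "u \<in> W" "\<And>x. u x \<le> t"
  shows "Psi u \<le> A * F t"
proof -
  have "Psi u \<le> (LINT x|\<mu>. \<alpha> x * F t)"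
    unfolding Psi_def
  proof (rule integral_mono_AE)
    show "AE x in \<mu>. \<alpha> x * F (u x) \<le> \<alpha> x * F t"
      using \<alpha>_bounds by eventually_elim (use F_mono assms in \<open>auto intro!: mult_left_mono\<close>)
  qed (use integrable_\<alpha> Psi_integrable[OF assms(1)] in auto)
  then show ?thesis by (simp add: A_def)
qed

lemma E_zero: "E (\<lambda>_. 0) = 0"
  by (simp add: E_def G_zero Psi_def)

text \<open>Neither term can raise the energy: truncation does not increase \<open>G\<close>, and
  \<open>F\<close> is nondecreasing because \<open>f\<close> is nonnegative, so \<open>Psi\<close>
  does not decrease.\<close>

lemma E_pos_part:
  assumes "u \<in> W"
  shows "E (\<lambda>x. max 0 (u x)) \<le> E u"
proof -
  note P = W_pos_part[OF assms]
  have "Psi u \<le> Psi (\<lambda>x. max 0 (u x))"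
    unfolding Psi_def
  proof (rule integral_mono_AE)
    show "AE x in \<mu>. \<alpha> x * F (u x) \<le> \<alpha> x * F (max 0 (u x))"
      using \<alpha>_bounds by eventually_elim (auto intro!: mult_left_mono F_mono)
  qed (use Psi_integrable[OF assms] Psi_integrable[OF P(1)] in auto)
  then have "lam * Psi u \<le> lam * Psi (\<lambda>x. max 0 (u x))" using lam by simp
  moreover have "G (\<lambda>x. max 0 (u x)) / p \<le> G u / p" using P(2) p_gt_1 by (intro divide_right_mono) auto
  ultimately show ?thesis by (simp add: E_def)
qed

subsection \<open>Critical points are weak solutions\<close>

text \<open>\<open>p\<close> times it is the derivative at \<open>t = 0\<close> of the Gagliardo
  integrand of \<open>u + t * \<phi>\<close>; this \<open>p\<close> cancels against
  \<open>G u / p\<close> in \<open>E\<close>.\<close>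

definition weak_integrand :: "('a \<Rightarrow> real) \<Rightarrow> ('a \<Rightarrow> real) \<Rightarrow> 'a \<times> 'a \<Rightarrow> real" where
  "weak_integrand u \<phi> = (\<lambda>(x, y). \<bar>u x - u y\<bar> powr (p - 2) * (u x - u y) * (\<phi> x - \<phi> y) /
             norm (x - y) powr (real DIM('a) + p * s))"

lemma weak_integrand_borel:
  assumes [measurable]: "u \<in> borel_measurable borel" "\<phi> \<in> borel_measurable borel"
  shows "weak_integrand u \<phi> \<in> borel_measurable borel"
proof -
  have "weak_integrand u \<phi> \<in> borel_measurable (borel \<Otimes>\<^sub>M borel)" unfolding weak_integrand_def by measurable
  then show ?thesis by (simp add: borel_prod)
qed

lemma DERIV_G:
  assumes u: "u \<in> W" and \<phi>: "\<phi> \<in> W"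
  shows "((\<lambda>t. G (\<lambda>x. u x + t * \<phi> x)) has_real_derivative p * (LINT z|lborel. weak_integrand u \<phi> z)) (at 0)"
proof -
  have "((\<lambda>t. G (\<lambda>x. u x + t * \<phi> x)) has_real_derivative (LINT z|lborel. p * weak_integrand u \<phi> z)) (at 0)"
    unfolding G_def
  proof (rule DERIV_integral(2)[where w = "\<lambda>z. p * 2 powr p * (gagliardo_integrand s p u z + gagliardo_integrand s p \<phi> z)"])
    show "integrable lborel (gagliardo_integrand s p (\<lambda>x. u x + t * \<phi> x))" for t
      using W_add_scaled[OF u \<phi>] by (rule W_integrable)
    show "(\<lambda>z. p * weak_integrand u \<phi> z) \<in> borel_measurable lborel"
      using weak_integrand_borel[OF W_borel[OF u] W_borel[OF \<phi>]] by simp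
    show "integrable lborel (\<lambda>z. p * 2 powr p * (gagliardo_integrand s p u z + gagliardo_integrand s p \<phi> z))"
      using W_integrable[OF u] W_integrable[OF \<phi>] by auto
    show "((\<lambda>t. gagliardo_integrand s p (\<lambda>x. u x + t * \<phi> x) z) has_real_derivative p * weak_integrand u \<phi> z) (at 0)" for z
    proof (cases z)
      case (Pair x y)
      have "((\<lambda>t. \<bar>(u x - u y) + t * (\<phi> x - \<phi> y)\<bar> powr p) has_real_derivative
          p * (\<bar>(u x - u y) + 0 * (\<phi> x - \<phi> y)\<bar> powr (p - 2) * ((u x - u y) + 0 * (\<phi> x - \<phi> y))) * (\<phi> x - \<phi> y)) (at 0)"
        by (rule DERIV_chain2[OF abs_powr_deriv[OF p_gt_1]]) (auto intro!: derivative_eq_intros)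
      from DERIV_cdivide[OF this, of "norm (x - y) powr (real DIM('a) + p * s)"]
      show ?thesis by (simp add: Pair gagliardo_integrand_def weak_integrand_def algebra_simps)
    qed
    fix t :: real assume t: "\<bar>t\<bar> \<le> 1"
    show "AE z in lborel. \<bar>gagliardo_integrand s p (\<lambda>x. u x + t * \<phi> x) z - gagliardo_integrand s p (\<lambda>x. u x + 0 * \<phi> x) z\<bar>
        \<le> \<bar>t\<bar> * (p * 2 powr p * (gagliardo_integrand s p u z + gagliardo_integrand s p \<phi> z))"
    proof (rule AE_I2)
      fix z :: "'a \<times> 'a"
      obtain x y where z: "z = (x, y)" by (cases z)
      define n where "n = norm (x - y) powr (real DIM('a) + p * s)"
      define a where "a = u x - u y"
      define b where "b = \<phi> x - \<phi> y"
      have e: "(u x + t * \<phi> x) - (u y + t * \<phi> y) = a + t * b" by (simp add: a_def b_def algebra_simps)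
      have "\<bar>\<bar>a + t * b\<bar> powr p - \<bar>a\<bar> powr p\<bar> / n \<le> \<bar>t\<bar> * (p * 2 powr p * (\<bar>a\<bar> powr p + \<bar>b\<bar> powr p)) / n"
        using abs_powr_increment_le[OF p_gt_1 t] by (intro divide_right_mono) (auto simp: n_def)
      then show "\<bar>gagliardo_integrand s p (\<lambda>x. u x + t * \<phi> x) z - gagliardo_integrand s p (\<lambda>x. u x + 0 * \<phi> x) z\<bar>
        \<le> \<bar>t\<bar> * (p * 2 powr p * (gagliardo_integrand s p u z + gagliardo_integrand s p \<phi> z))"
        unfolding z gagliardo_integrand_def
        by (simp add: e n_def[symmetric] a_def[symmetric] b_def[symmetric] diff_divide_distrib[symmetric]
            add_divide_distrib[symmetric] abs_divide)
          (simp add: n_def)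
    qed
  qed
  then show ?thesis by simp
qed

lemma DERIV_Psi:
  assumes u: "u \<in> W" and \<phi>: "\<phi> \<in> W"
  shows "((\<lambda>t. Psi (\<lambda>x. u x + t * \<phi> x)) has_real_derivative (LINT x|\<mu>. \<alpha> x * f (u x) * \<phi> x)) (at 0)"
  unfolding Psi_def
proof -
  obtain Ku where Ku: "Ku > 0" "\<And>x. \<bar>u x\<bar> \<le> Ku" using W_bounded[OF u] by metis
  obtain Kp where Kp: "Kp > 0" "\<And>x. \<bar>\<phi> x\<bar> \<le> Kp" using W_bounded[OF \<phi>] by metis
  \<comment> \<open>\<open>K\<close> bounds \<open>u + t * \<phi>\<close> for every \<open>t\<close>
    with \<open>|t| <= 1\<close>; the bound \<open>B\<close> of \<open>f\<close> on
    \<open>{-K..K}\<close> is then a Lipschitz constant of \<open>F\<close> on that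
    interval.\<close>
  define K where "K = Ku + Kp"
  have "compact (f ` {-K..K})"
    by (intro compact_continuous_image) (auto intro: continuous_on_subset[OF f_cont])
  then obtain B where B: "B > 0" "\<And>y. y \<in> f ` {-K..K} \<Longrightarrow> norm y \<le> B"
    using compact_imp_bounded bounded_pos by metis
  have fB: "f t \<le> B" if "\<bar>t\<bar> \<le> K" for t 
  proof -
    have "f t \<in> f ` {-K..K}" using that by (intro imageI) auto
    from B(2)[OF this] show ?thesis by simp
  qed
  show "((\<lambda>t. LINT x|\<mu>. \<alpha> x * F (u x + t * \<phi> x)) has_real_derivative (LINT x|\<mu>. \<alpha> x * f (u x) * \<phi> x)) (at 0)"
  proof (rule DERIV_integral(2)[where w = "\<lambda>x. \<alpha> x * (B * Kp)"])
    show "integrable \<mu> (\<lambda>x. \<alpha> x * F (u x + t * \<phi> x))" for t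
      using W_add_scaled[OF u \<phi>] by (rule Psi_integrable)
    have "(\<lambda>x. f (u x)) \<in> borel_measurable borel"
      by (rule measurable_compose[OF W_borel[OF u] borel_measurable_continuous_onI[OF f_cont]])
    then show "(\<lambda>x. \<alpha> x * f (u x) * \<phi> x) \<in> borel_measurable \<mu>"
      using \<alpha>_meas W_borel[OF \<phi>] borel_measurable_\<mu> by (intro borel_measurable_times)
    show "((\<lambda>t. \<alpha> x * F (u x + t * \<phi> x)) has_real_derivative \<alpha> x * f (u x) * \<phi> x) (at 0)" for x
    proof -
      have "((\<lambda>t. F (u x + t * \<phi> x)) has_real_derivative f (u x + 0 * \<phi> x) * \<phi> x) (at 0)"
        by (rule DERIV_chain2[OF DERIV_F]) (auto intro!: derivative_eq_intros)
      from DERIV_cmult[OF this, of "\<alpha> x"] show ?thesis by (simp add: mult.assoc)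
    qed
    show "integrable \<mu> (\<lambda>x. \<alpha> x * (B * Kp))" using integrable_\<alpha> by simp
    fix t :: real assume t: "\<bar>t\<bar> \<le> 1"
    show "AE x in \<mu>. \<bar>\<alpha> x * F (u x + t * \<phi> x) - \<alpha> x * F (u x + 0 * \<phi> x)\<bar> \<le> \<bar>t\<bar> * (\<alpha> x * (B * Kp))"
      using \<alpha>_bounds
    proof eventually_elim
      case (elim x)
      have tp: "\<bar>t * \<phi> x\<bar> \<le> \<bar>t\<bar> * Kp" unfolding abs_mult using Kp by (intro mult_left_mono) auto
      also have "\<dots> \<le> 1 * Kp" using t Kp by (intro mult_right_mono) auto
      finally have "\<bar>u x + t * \<phi> x\<bar> \<le> K" using Ku(2)[of x] by (auto simp: K_def)
      moreover have "\<bar>u x\<bar> \<le> K" using Ku(2)[of x] Kp by (auto simp: K_def)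
      ultimately have "\<bar>F (u x + t * \<phi> x) - F (u x)\<bar> \<le> B * \<bar>u x + t * \<phi> x - u x\<bar>"
        using fB by (intro F_increment)
      also have "\<dots> \<le> B * (\<bar>t\<bar> * Kp)" using tp B(1) by (intro mult_left_mono) simp_all
      finally have "\<alpha> x * \<bar>F (u x + t * \<phi> x) - F (u x)\<bar> \<le> \<alpha> x * (B * (\<bar>t\<bar> * Kp))"
        using elim by (intro mult_left_mono) auto
      then show ?case using elim
        by (simp add: right_diff_distrib[symmetric] abs_mult mult_ac)
    qed
  qed
qed

text \<open>\<open>G\<close> is differentiable, hence continuous, along
  \<open>u + t * \<phi>\<close> at \<open>t = 0\<close>, so \<open>G u < R\<close> keeps these
  functions in the ball for small \<open>t\<close> of either sign. Thus 0 is a local minimum of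
  \<open>e\<close>, and its derivative, the difference of the two sides of the weak equation,
  vanishes. \<open>rep\<close> reduces an arbitrary test function to a continuous one.\<close>

lemma weak_solution_of_local_min:
  assumes u: "u \<in> W" and GR: "G u < R" and min: "\<And>v. v \<in> W \<Longrightarrow> G v \<le> R \<Longrightarrow> E u \<le> E v"
    and rep: "\<And>u. u \<in> X0 s p \<Omega> \<Longrightarrow> \<exists>v\<in>W. AE x in lborel. u x = v x"
  shows "weak_solution s p \<Omega> \<alpha> f lam u"
  unfolding weak_solution_def
proof (intro conjI ballI)
  show "u \<in> X0 s p \<Omega>" using u by (rule W_subset_X0)
  fix \<phi>0 assume \<phi>0: "\<phi>0 \<in> X0 s p \<Omega>"
  obtain \<phi> where \<phi>: "\<phi> \<in> W" and eq: "AE x in lborel. \<phi>0 x = \<phi> x" using rep[OF \<phi>0] by blast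
  define e where "e t = E (\<lambda>x. u x + t * \<phi> x)" for t
  have dG: "((\<lambda>t. G (\<lambda>x. u x + t * \<phi> x)) has_real_derivative p * (LINT z|lborel. weak_integrand u \<phi> z)) (at 0)"
    using u \<phi> by (rule DERIV_G)
  have de: "(e has_real_derivative p * (LINT z|lborel. weak_integrand u \<phi> z) / p - lam * (LINT x|\<mu>. \<alpha> x * f (u x) * \<phi> x)) (at 0)"
    unfolding e_def E_def
    by (intro DERIV_diff DERIV_cdivide DERIV_cmult dG DERIV_Psi u \<phi>)
  have "(\<lambda>t. G (\<lambda>x. u x + t * \<phi> x)) \<midarrow>0\<rightarrow> G u"
    using DERIV_isCont[OF dG] by (simp add: isCont_def)
  then have "\<forall>\<^sub>F t in at 0. G (\<lambda>x. u x + t * \<phi> x) < R"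
    using GR by (rule order_tendstoD(2))
  then obtain d where d: "d > 0" "\<And>t. t \<noteq> 0 \<Longrightarrow> \<bar>t\<bar> < d \<Longrightarrow> G (\<lambda>x. u x + t * \<phi> x) < R"
    by (auto simp: eventually_at dist_real_def)
  have "e 0 \<le> e t" if "\<bar>t\<bar> < d" for t
  proof (cases "t = 0")
    case False
    then have "E u \<le> E (\<lambda>x. u x + t * \<phi> x)"
      using d(2)[OF False that] by (intro min W_add_scaled u \<phi>) auto
    then show ?thesis by (simp add: e_def)
  qed simp
  then have "p * (LINT z|lborel. weak_integrand u \<phi> z) / p - lam * (LINT x|\<mu>. \<alpha> x * f (u x) * \<phi> x) = 0"
    using d(1) by (intro DERIV_local_min[OF de]) auto
  then have main: "(LINT z|lborel. weak_integrand u \<phi> z) = lam * (LINT x|\<mu>. \<alpha> x * f (u x) * \<phi> x)"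
    using p_gt_1 by simp
  have "AE z in lborel. weak_integrand u \<phi>0 z = weak_integrand u \<phi> z"
    using AE_lborel_pair_fst_snd[OF eq] by eventually_elim (auto simp: weak_integrand_def split_def)
  then have 1: "(LINT z|lebesgue. weak_integrand u \<phi>0 z) = (LINT z|lborel. weak_integrand u \<phi> z)"
    by (rule integral_lebesgue_eq_lborel) (intro weak_integrand_borel W_borel u \<phi>)
  have fu: "(\<lambda>x. f (u x)) \<in> borel_measurable \<mu>"
    by (intro borel_measurable_\<mu> measurable_compose[OF W_borel[OF u] borel_measurable_continuous_onI[OF f_cont]])
  have "\<phi>0 \<in> borel_measurable lebesgue" using \<phi>0 by (simp add: X0_def frac_sobolev_def)
  then have m0: "\<phi>0 \<in> borel_measurable \<mu>" by (rule measurable_restrict_space1)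
  have 2: "(LINT x|\<mu>. \<alpha> x * f (u x) * \<phi>0 x) = (LINT x|\<mu>. \<alpha> x * f (u x) * \<phi> x)"
  proof (rule integral_cong_AE)
    show "AE x in \<mu>. \<alpha> x * f (u x) * \<phi>0 x = \<alpha> x * f (u x) * \<phi> x"
      using AE_\<mu>[OF eq] by eventually_elim auto
  qed (intro borel_measurable_times \<alpha>_meas fu m0 borel_measurable_\<mu> W_borel \<phi>)+
  show "(LINT (x, y)|lebesgue. \<bar>u x - u y\<bar> powr (p - 2) * (u x - u y) * (\<phi>0 x - \<phi>0 y) /
             norm (x - y) powr (real DIM('a) + p * s)) = lam * (LINT x|\<mu>. \<alpha> x * f (u x) * \<phi>0 x)"
    using main 1 2 by (simp add: weak_integrand_def)
qed

end

subsection \<open>Minimisers on balls\<close>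

context frac_problem
begin

text \<open>
  The minimising sequence is equicontinuous by the Morrey estimate, so a subsequence converges
  pointwise; \<open>Psi\<close> passes to the limit by dominated convergence and \<open>G\<close> by Fatou's lemma.
\<close>

lemma minimiser_exists:
  assumes C: "C > 0" "0 < q" "q < 1" and H: "H > 0"
    and bnd: "\<And>u x. \<lbrakk>u \<in> W; G u \<le> H powr p\<rbrakk> \<Longrightarrow> \<bar>u x\<bar> \<le> C * H"
    and mod: "\<And>u k x y. \<lbrakk>u \<in> W; G u \<le> H powr p; dist x y \<le> 1 / 2 ^ k\<rbrakk> \<Longrightarrow> \<bar>u x - u y\<bar> \<le> C * q ^ k * H"
  shows "\<exists>u\<in>W. G u \<le> H powr p \<and> (\<forall>v\<in>W. G v \<le> H powr p \<longrightarrow> E u \<le> E v)"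
proof -
  define S where "S = {v \<in> W. G v \<le> H powr p}"
  have lower: "E v \<ge> - (lam * (A * F (C * H)))" if "v \<in> S" for v
  proof -
    have "Psi v \<le> A * F (C * H)"
      using that bnd[of v] by (intro Psi_le) (auto simp: S_def abs_le_iff)
    then have "lam * Psi v \<le> lam * (A * F (C * H))" using lam by simp
    moreover have "G v / p \<ge> 0" using p_gt_1 by simp
    ultimately show ?thesis by (simp add: E_def)
  qed
  have ne: "(\<lambda>_. 0) \<in> S" using H by (simp add: S_def zero_in_W G_zero)
  define I where "I = Inf (E ` S)"
  have bdd: "bdd_below (E ` S)" using lower by (intro bdd_belowI) auto
  have I_le: "I \<le> E v" if "v \<in> S" for v
    unfolding I_def using that bdd by (intro cInf_lower) auto
  have "\<exists>v\<in>S. E v < I + 1 / Suc n" for n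
  proof -
    have "Inf (E ` S) < I + 1 / Suc n" by (simp add: I_def)
    then show ?thesis using ne bdd by (subst (asm) cInf_less_iff) auto
  qed
  then obtain v where v: "\<And>n. v n \<in> S" "\<And>n. E (v n) < I + 1 / Suc n" by metis
  have vW: "v n \<in> W" and vG: "G (v n) \<le> H powr p" for n using v(1) by (auto simp: S_def)
  have vE: "(\<lambda>n. E (v n)) \<longlonglongrightarrow> I"
  proof (rule tendsto_sandwich[where f = "\<lambda>_. I" and h = "\<lambda>n. I + 1 / Suc n"])
    show "(\<lambda>n. I + 1 / Suc n) \<longlonglongrightarrow> I"
      using tendsto_add[OF tendsto_const LIMSEQ_inverse_real_of_nat] by (simp add: inverse_eq_divide)
  qed (use I_le v(1) less_imp_le[OF v(2)] in \<open>auto intro!: always_eventually\<close>)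
  have "\<exists>g r. strict_mono (r :: nat \<Rightarrow> nat) \<and>
      (\<forall>e>0. \<exists>N. \<forall>n x. n \<ge> N \<and> x \<in> closure \<Omega> \<longrightarrow> norm (v (r n) x - g x) < e)"
  proof (rule Arzela_Ascoli[of "closure \<Omega>" v "C * H"])
    show "compact (closure \<Omega>)" using \<Omega>_bounded by (simp add: compact_closure)
    show "norm (v n x) \<le> C * H" for n x using bnd[OF vW vG] by simp
    fix x :: 'a and e :: real assume "e > 0"
    then obtain k where k: "(C * H) * q ^ k < e" using geometric_less C by metis
    have "norm (v n x - v n y) < e" if "norm (x - y) < 1 / 2 ^ k" for n y
      using mod[OF vW vG, of x y k n] that k by (simp add: dist_norm mult_ac)
    then show "\<exists>d>0. \<forall>n y. y \<in> closure \<Omega> \<and> norm (x - y) < d \<longrightarrow> norm (v n x - v n y) < e"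
      by (intro exI[of _ "1 / 2 ^ k"]) auto
  qed blast
  then obtain g r where r: "strict_mono (r :: nat \<Rightarrow> nat)"
    and g: "\<And>e. 0 < e \<Longrightarrow> \<exists>N. \<forall>n x. n \<ge> N \<and> x \<in> closure \<Omega> \<longrightarrow> norm (v (r n) x - g x) < e"
    by blast
  \<comment> \<open>Arzela-Ascoli gives the limit on the compact closure only; outside it all
    \<open>v n\<close> vanish.\<close>
  define u where "u x = (if x \<in> closure \<Omega> then g x else 0)" for x
  have lim: "(\<lambda>n. v (r n) x) \<longlonglongrightarrow> u x" for x
  proof (cases "x \<in> closure \<Omega>")
    case True
    show ?thesis
    proof (rule LIMSEQ_I)
      fix e :: real assume "0 < e"
      from g[OF this] obtain N where "\<And>n. n \<ge> N \<Longrightarrow> norm (v (r n) x - g x) < e"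
        using True by blast
      then show "\<exists>no. \<forall>n\<ge>no. norm (v (r n) x - u x) < e" using True by (auto simp: u_def)
    qed
  next
    case False
    then show ?thesis using W_zero_outside[OF vW] by (simp add: u_def)
  qed
  have ubnd: "\<bar>u x\<bar> \<le> C * H" for x
    using bnd[OF vW vG] by (intro LIMSEQ_le_const2[OF tendsto_rabs[OF lim]]) blast
  have cont: "continuous_on UNIV u"
  proof (rule continuous_of_dyadic_modulus[OF C(2,3)])
    fix k and x y :: 'a assume xy: "dist x y \<le> 1 / 2 ^ k"
    have "(\<lambda>n. \<bar>v (r n) x - v (r n) y\<bar>) \<longlonglongrightarrow> \<bar>u x - u y\<bar>" by (intro tendsto_intros lim)
    then show "\<bar>u x - u y\<bar> \<le> (C * H) * q ^ k"
      using mod[OF vW vG xy] by (intro LIMSEQ_le_const2) (auto simp: mult_ac)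
  qed
  then have ub: "u \<in> borel_measurable borel" by (rule borel_measurable_continuous_onI)
  \<comment> \<open>The exceptional null sets depend on \<open>n\<close>; being countably many, they
    are merged before the limit is taken.\<close>
  have "AE x in lborel. \<forall>n. x \<notin> \<Omega> \<longrightarrow> v (r n) x = 0"
    using vW by (subst AE_all_countable) (auto simp: W_def)
  then have u0: "AE x in lborel. x \<notin> \<Omega> \<longrightarrow> u x = 0"
  proof eventually_elim
    case (elim x)
    then show ?case using lim[of x] by (auto simp: LIMSEQ_const_iff)
  qed
  have Psi_lim: "(\<lambda>n. Psi (v (r n))) \<longlonglongrightarrow> Psi u"
    unfolding Psi_def
  proof (rule integral_dominated_convergence[where w = "\<lambda>x. \<alpha> x * max (F (C * H)) (- F (- (C * H)))"])
    have m: "(\<lambda>x. \<alpha> x * F (w x)) \<in> borel_measurable \<mu>" if "w \<in> borel_measurable borel" for w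
      using \<alpha>_meas borel_measurable_\<mu>[OF F_comp_borel[OF that]] by (intro borel_measurable_times)
    show "(\<lambda>x. \<alpha> x * F (u x)) \<in> borel_measurable \<mu>" using m ub .
    show "(\<lambda>x. \<alpha> x * F (v (r n) x)) \<in> borel_measurable \<mu>" for n using m W_borel[OF vW] .
    show "integrable \<mu> (\<lambda>x. \<alpha> x * max (F (C * H)) (- F (- (C * H))))"
      using integrable_\<alpha> by (rule integrable_mult_left)
    show "AE x in \<mu>. (\<lambda>n. \<alpha> x * F (v (r n) x)) \<longlonglongrightarrow> \<alpha> x * F (u x)"
      by (intro AE_I2 tendsto_intros isCont_tendsto_compose[OF DERIV_isCont[OF DERIV_F]] lim)
    show "AE x in \<mu>. norm (\<alpha> x * F (v (r n) x)) \<le> \<alpha> x * max (F (C * H)) (- F (- (C * H)))" for n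
      using \<alpha>_bounds
      by eventually_elim
        (use F_bounded[OF bnd[OF vW vG]] in \<open>auto simp: abs_mult intro!: mult_left_mono\<close>)
  qed
  \<comment> \<open>Since \<open>E\<close> and \<open>Psi\<close> converge along the subsequence,
    the limit of \<open>G\<close> is forced, and Fatou's lemma applies without a further
    subsequence.\<close>
  define l where "l = p * (I + lam * Psi u)"
  have "(\<lambda>n. p * (E (v (r n)) + lam * Psi (v (r n)))) \<longlonglongrightarrow> l"
    unfolding l_def by (intro tendsto_intros Psi_lim LIMSEQ_subseq_LIMSEQ[OF vE r, unfolded comp_def])
  then have Gl: "(\<lambda>n. G (v (r n))) \<longlonglongrightarrow> l" using p_gt_1 by (simp add: E_def)
  have glim: "(\<lambda>n. gagliardo_integrand s p (v (r n)) z) \<longlonglongrightarrow> gagliardo_integrand s p u z" for z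
  proof (cases z)
    case (Pair x y)
    have "(\<lambda>n. \<bar>v (r n) x - v (r n) y\<bar> powr p) \<longlonglongrightarrow> \<bar>u x - u y\<bar> powr p"
      using p_gt_1 by (intro tendsto_powr' tendsto_intros lim) auto
    then show ?thesis unfolding Pair gagliardo_integrand_def
      by (cases "x = y") (auto intro!: tendsto_divide)
  qed
  note fat = fatou_real[OF W_integrable[OF vW] gagliardo_nonneg glim Gl[unfolded G_def]]
  have uW: "u \<in> W" using cont u0 fat(1) by (simp add: W_def)
  have "l \<le> H powr p" using Gl vG by (intro LIMSEQ_le_const2) auto
  then have uG: "G u \<le> H powr p" using fat(2) by (simp add: G_def)
  have "G u / p \<le> l / p" using fat(2) p_gt_1 by (intro divide_right_mono) (auto simp: G_def)
  then have "E u \<le> I" using p_gt_1 by (simp add: E_def l_def)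
  then have "E u \<le> E w" if "w \<in> W" "G w \<le> H powr p" for w
    using I_le[of w] that by (simp add: S_def)
  with uW uG show ?thesis by blast
qed

text \<open>
  On the ball of radius \<open>t / c\<close> all functions are at most \<open>t\<close>. A minimiser has energy at most
  \<open>E 0 = 0\<close>, so if \<open>F t\<close> is small compared with \<open>(t / c) powr p\<close> it lies in the interior of the ball.
\<close>

lemma solutions_exist:
  obtains c where "c > 0"
    "\<And>u h x. u \<in> W \<Longrightarrow> h > 0 \<Longrightarrow> G u \<le> h powr p \<Longrightarrow> \<bar>u x\<bar> \<le> c * h"
    "\<And>t. t > 0 \<Longrightarrow> p * lam * A * F t < (t / c) powr p \<Longrightarrow>
      \<exists>u\<in>W. weak_solution s p \<Omega> \<alpha> f lam u \<and> (\<forall>x. 0 \<le> u x) \<and> (\<forall>x. u x \<le> t) \<and> G u \<le> (t / c) powr p \<and>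
        (\<forall>v\<in>W. G v \<le> (t / c) powr p \<longrightarrow> E u \<le> E v)"
proof (rule morrey_X0)
  fix C q
  assume C: "C > 0" "0 < q" "q < 1"
    and rep: "\<And>u. u \<in> X0 s p \<Omega> \<Longrightarrow> \<exists>v\<in>W. AE x in lborel. u x = v x"
    and bnd: "\<And>u H x. \<lbrakk>u \<in> W; H > 0; G u \<le> H powr p\<rbrakk> \<Longrightarrow> \<bar>u x\<bar> \<le> C * H"
    and mod: "\<And>u H k x y. \<lbrakk>u \<in> W; H > 0; G u \<le> H powr p; dist x y \<le> 1 / 2 ^ k\<rbrakk> \<Longrightarrow> \<bar>u x - u y\<bar> \<le> C * q ^ k * H"
  show thesis
  proof (rule that[of C])
    show "C > 0" by (rule C(1))
    show "\<bar>u x\<bar> \<le> C * h" if "u \<in> W" "h > 0" "G u \<le> h powr p" for u h x using bnd[OF that] .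
    fix t :: real assume t: "t > 0" and small: "p * lam * A * F t < (t / C) powr p"
    define H where "H = t / C"
    have H: "H > 0" "C * H = t" using C t by (auto simp: H_def)
    have "\<exists>u\<in>W. G u \<le> H powr p \<and> (\<forall>v\<in>W. G v \<le> H powr p \<longrightarrow> E u \<le> E v)"
    proof (rule minimiser_exists[OF C H(1)])
      show "\<bar>u x\<bar> \<le> C * H" if "u \<in> W" "G u \<le> H powr p" for u x
        using bnd[OF that(1) H(1) that(2)] .
      show "\<bar>u x - u y\<bar> \<le> C * q ^ k * H"
        if "u \<in> W" "G u \<le> H powr p" "dist x y \<le> 1 / 2 ^ k" for u k x y
        using mod[OF that(1) H(1) that(2,3)] .
    qed
    then obtain u0 where u0: "u0 \<in> W" "G u0 \<le> H powr p"
      "\<And>v. v \<in> W \<Longrightarrow> G v \<le> H powr p \<Longrightarrow> E u0 \<le> E v"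
      by blast
    define u where "u x = max 0 (u0 x)" for x
    have u: "u \<in> W" "G u \<le> H powr p" using W_pos_part[OF u0(1)] u0(2) by (auto simp: u_def[abs_def])
    have min: "E u \<le> E v" if "v \<in> W" "G v \<le> H powr p" for v
      using E_pos_part[OF u0(1)] u0(3)[OF that] by (simp add: u_def[abs_def])
    have ut: "u x \<le> t" for x using bnd[OF u(1) H(1) u(2), of x] H by simp
    have "E u \<le> E (\<lambda>_. 0)" using zero_in_W H by (intro min) (auto simp: G_zero)
    then have "G u / p \<le> lam * Psi u" by (simp add: E_zero) (simp add: E_def)
    also have "\<dots> \<le> lam * (A * F t)" using Psi_le[OF u(1) ut] lam by simp
    finally have "G u \<le> p * lam * A * F t" using p_gt_1 by (simp add: field_simps)
    then have "G u < H powr p" using small by (simp add: H_def)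
    then have "weak_solution s p \<Omega> \<alpha> f lam u"
      by (rule weak_solution_of_local_min[OF u(1) _ min rep]) auto
    moreover have "\<forall>x. 0 \<le> u x" by (simp add: u_def)
    ultimately show "\<exists>u\<in>W. weak_solution s p \<Omega> \<alpha> f lam u \<and> (\<forall>x. 0 \<le> u x) \<and> (\<forall>x. u x \<le> t) \<and> G u \<le> (t / C) powr p \<and>
        (\<forall>v\<in>W. G v \<le> (t / C) powr p \<longrightarrow> E u \<le> E v)"
      using u ut min by (intro bexI[of _ u]) (auto simp: H_def)
  qed
qed

text \<open>The sup bound is applied with \<open>h = e / c\<close> for arbitrary
  \<open>e > 0\<close>, as \<open>h = 0\<close> is not admissible.\<close>

lemma G_zero_imp_zero:
  assumes "u \<in> W" "G u = 0" and c: "\<And>u h x. u \<in> W \<Longrightarrow> h > 0 \<Longrightarrow> G u \<le> h powr p \<Longrightarrow> \<bar>u x\<bar> \<le> c * h"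
    and "c > 0"
  shows "u = (\<lambda>_. 0)"
proof
  fix x
  have "\<bar>u x\<bar> \<le> e" if "e > 0" for e :: real
    using c[OF assms(1), of "e / c" x] that assms by simp
  then show "u x = 0" using field_le_epsilon[of "\<bar>u x\<bar>" 0] by simp
qed

text \<open>On a set \<open>K\<close> where the cutoff is 1 the integrand of \<open>Psi\<close> is
  at least \<open>m * F t\<close>, and elsewhere it is nonnegative; hence \<open>b\<close> is
  \<open>lam * m\<close> times the measure of \<open>K\<close>.\<close>

lemma bump_energy:
  obtains w g b where "w \<in> W" "G w = g" "b > 0" "\<And>t. t \<ge> 0 \<Longrightarrow> E (\<lambda>x. t * w x) \<le> t powr p * g / p - b * F t"
proof -
  obtain w K where w: "w \<in> W" "\<And>x. 0 \<le> w x" "K \<subseteq> \<Omega>" "open K" "K \<noteq> {}" "\<And>x. x \<in> K \<Longrightarrow> w x = 1"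
    using cutoff_in_W by metis
  have Km: "K \<in> sets \<mu>" using w \<Omega>_open by (auto simp: sets_restrict_space_iff)
  have fin: "emeasure \<mu> K \<noteq> \<infinity>" using finite_measure.emeasure_finite[OF finite_\<mu>] by simp
  define k where "k = measure \<mu> K"
  have "measure \<mu> K = measure lebesgue K"
    using w \<Omega>_lebesgue by (intro measure_restrict_space) auto
  moreover have "measure lebesgue K > 0"
  proof -
    have "bounded K" using bounded_subset[OF \<Omega>_bounded w(3)] .
    then have "K \<in> lmeasurable" using w(4) lmeasurable_open by blast
    moreover have "\<not> negligible K" using open_not_negligible w by blast
    ultimately show ?thesis using measure_nonneg[of lebesgue K]
      by (auto simp: negligible_iff_measure less_le)
  qed
  ultimately have k: "k > 0" by (simp add: k_def)
  have "E (\<lambda>x. t * w x) \<le> t powr p * G w / p - (lam * m * k) * F t" if t: "t \<ge> 0" for t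
  proof -
    note tw = W_scaled[OF w(1), of t]
    have "m * k * F t = (LINT x|\<mu>. (m * F t) * indicator K x)"
      using Km fin Int_absorb2[OF w(3)] by (simp add: k_def)
    also have "\<dots> \<le> Psi (\<lambda>x. t * w x)"
      unfolding Psi_def
    proof (rule integral_mono_AE)
      show "integrable \<mu> (\<lambda>x. (m * F t) * indicator K x)"
        using Km fin by (intro integrable_mult_right integrable_real_indicator) (auto simp: less_top)
      show "AE x in \<mu>. (m * F t) * indicator K x \<le> \<alpha> x * F (t * w x)"
        using \<alpha>_lower
        by eventually_elim
          (use m w(2,6) t F_nonneg in \<open>auto simp: indicator_def intro!: mult_right_mono mult_nonneg_nonneg\<close>)
    qed (use Psi_integrable[OF tw(1)] in auto)
    finally have "lam * (m * k * F t) \<le> lam * Psi (\<lambda>x. t * w x)" using lam by simp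
    then show ?thesis using t by (simp add: E_def tw(2) mult_ac)
  qed
  moreover have "lam * m * k > 0" using lam m k by simp
  ultimately show ?thesis using that[of w "G w" "lam * m * k"] w(1) by blast
qed

end

subsection \<open>Solutions of large and of small norm\<close>

context frac_problem
begin

lemma X0_norm_powr: "u \<in> W \<Longrightarrow> X0_norm s p u powr p = G u"
  using p_gt_1 by (simp add: X0_norm_W powr_powr)

text \<open>Members of \<open>W\<close> that agree almost everywhere share their norm;
  contrapositively, distinct norms give distinct elements of the space.\<close>

lemma W_AE_eq:
  assumes "u \<in> W" "v \<in> W" "AE x in lebesgue. u x = v x"
  shows "u = v"
proof
  fix x
  have "AE x in lborel. x \<in> UNIV \<longrightarrow> u x - v x = 0"
    using assms(3) unfolding AE_completion_iff by eventually_elim auto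
  moreover have "continuous_on UNIV (\<lambda>x. u x - v x)"
    using assms by (auto simp: W_def intro!: continuous_intros)
  ultimately show "u x = v x"
    using continuous_AE_zero_on_open[of "\<lambda>x. u x - v x" UNIV x] by simp
qed

text \<open>Turns the liminf condition into the interiority condition of
  \<open>solutions_exist\<close>.\<close>

lemma small_quotient:
  assumes "c > 0"
  obtains e where "e > 0" "\<And>t. t > 0 \<Longrightarrow> F t / t powr p < e \<Longrightarrow> p * lam * A * F t < (t / c) powr p"
proof -
  \<comment> \<open>\<open>A_nonneg\<close> yields only \<open>A >= 0\<close>; the summand 1 makes
    \<open>D\<close> positive.\<close>
  define D where "D = p * lam * A + 1"
  have D: "D > 0" using A_nonneg lam p_gt_1 by (auto simp: D_def intro!: add_nonneg_pos mult_nonneg_nonneg)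
  show ?thesis
  proof (rule that[of "(1 / c) powr p / D"])
    show "(1 / c) powr p / D > 0" using D assms by simp
    fix t :: real assume t: "t > 0" and lt: "F t / t powr p < (1 / c) powr p / D"
    have "p * lam * A * F t \<le> D * F t"
      using F_nonneg[of t] t unfolding D_def by (intro mult_right_mono) auto
    also have "\<dots> < (1 / c) powr p * t powr p" using lt t D by (simp add: field_simps)
    also have "\<dots> = (t / c) powr p" using t assms by (simp add: powr_mult[symmetric])
    finally show "p * lam * A * F t < (t / c) powr p" .
  qed
qed

text \<open>First \<tau> is chosen by the limsup condition so that \<open>v\<close> has energy below
  \<open>- l\<close>, then \<open>t\<close> by the liminf condition so large that \<open>v\<close>
  lies in the ball of radius \<open>t / c\<close>. The minimiser on that ball has energy below
  \<open>- l\<close>, whereas every function of norm at most \<open>B'\<close> has energy above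
  \<open>- l\<close>.\<close>

lemma large_solution_exists:
  assumes liminf: "\<And>e. e > 0 \<Longrightarrow> \<exists>\<^sub>F t in at_top. F t / t powr p < e"
    and limsup: "\<And>K. \<exists>\<^sub>F t in at_top. F t / t powr p > K"
  shows "\<exists>u\<in>W. weak_solution s p \<Omega> \<alpha> f lam u \<and> (\<forall>x. u x \<ge> 0) \<and> B \<le> X0_norm s p u"
proof -
  obtain c where c: "c > 0"
    and cb: "\<And>u h x. u \<in> W \<Longrightarrow> h > 0 \<Longrightarrow> G u \<le> h powr p \<Longrightarrow> \<bar>u x\<bar> \<le> c * h"
    and sol: "\<And>t. t > 0 \<Longrightarrow> p * lam * A * F t < (t / c) powr p \<Longrightarrow>
      \<exists>u\<in>W. weak_solution s p \<Omega> \<alpha> f lam u \<and> (\<forall>x. 0 \<le> u x) \<and> (\<forall>x. u x \<le> t) \<and> G u \<le> (t / c) powr p \<and>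
        (\<forall>v\<in>W. G v \<le> (t / c) powr p \<longrightarrow> E u \<le> E v)"
    by (rule solutions_exist) blast
  obtain e where e: "e > 0" "\<And>t. t > 0 \<Longrightarrow> F t / t powr p < e \<Longrightarrow> p * lam * A * F t < (t / c) powr p"
    using small_quotient[OF c] by metis
  obtain w g b where w: "w \<in> W" "G w = g" "b > 0" "\<And>t. t \<ge> 0 \<Longrightarrow> E (\<lambda>x. t * w x) \<le> t powr p * g / p - b * F t"
    using bump_energy by metis
  \<comment> \<open>The sup bound \<open>cb\<close> requires a positive radius, and \<open>B\<close>
    is arbitrary.\<close>
  define B' where "B' = max B 1"
  have "B' > 0" by (simp add: B'_def)
  \<comment> \<open>On the ball of radius \<open>B'\<close> the energy is at least
    \<open>- lam * (A * F (c * B'))\<close>; the 1 makes the separation strict.\<close>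
  define l where "l = lam * (A * F (c * B')) + 1"
  have l: "l > 0" unfolding l_def B'_def using lam A_nonneg F_nonneg c
    by (intro add_nonneg_pos mult_nonneg_nonneg) auto
  \<comment> \<open>Asking for \<open>t >= 1\<close> ensures that the gap
    \<open>t powr p * l\<close> is at least \<open>l\<close>.\<close>
  have "\<exists>\<^sub>F t in at_top. F t / t powr p > (g / p + l) / b \<and> t \<ge> 1"
    using limsup eventually_ge_at_top by (rule frequently_eventually_frequently)
  then obtain \<tau> where \<tau>: "F \<tau> / \<tau> powr p > (g / p + l) / b" "\<tau> \<ge> 1" by (auto dest: frequently_ex)
  have "\<tau> powr p * (g / p + l) < b * F \<tau>" using \<tau> w(3) by (simp add: field_simps)
  moreover have "1 * l \<le> \<tau> powr p * l" using \<tau> l p_gt_1 by (intro mult_right_mono ge_one_powr_ge_zero) auto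
  ultimately have E\<tau>: "E (\<lambda>x. \<tau> * w x) < - l" using w(4)[of \<tau>] \<tau> by (simp add: distrib_left)
  define v where "v = (\<lambda>x. \<tau> * w x)"
  have v: "v \<in> W" unfolding v_def using w(1) by (rule W_scaled)
  \<comment> \<open>That \<open>t / c\<close> is at least 1 and at least \<open>G v\<close> gives
    \<open>G v <= (t / c) powr p\<close>, since \<open>p > 1\<close>.\<close>
  have "\<exists>\<^sub>F t in at_top. F t / t powr p < e \<and> t \<ge> c * max 1 (G v)"
    using liminf[OF e(1)] eventually_ge_at_top by (rule frequently_eventually_frequently)
  then obtain t where t: "F t / t powr p < e" "t \<ge> c * max 1 (G v)" by (auto dest: frequently_ex)
  have tc: "t / c \<ge> max 1 (G v)" using t(2) by (subst pos_le_divide_eq[OF c]) (simp only: mult.commute)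
  have t0: "t > 0" using tc c by (smt (verit) zero_less_divide_iff max.cobounded1)
  have "G v \<le> (t / c) powr 1" using tc t0 c by simp
  also have "\<dots> \<le> (t / c) powr p" using tc p_gt_1 by (intro powr_mono) auto
  finally have Gv: "G v \<le> (t / c) powr p" .
  obtain u where u: "u \<in> W" "weak_solution s p \<Omega> \<alpha> f lam u" "\<forall>x. 0 \<le> u x" "E u \<le> E v"
    using sol[OF t0 e(2)[OF t0 t(1)]] v Gv by blast
  have "B \<le> X0_norm s p u"
  proof (rule ccontr)
    assume "\<not> B \<le> X0_norm s p u"
    then have "X0_norm s p u \<le> B'" by (simp add: B'_def)
    then have "X0_norm s p u powr p \<le> B' powr p"
      using p_gt_1 by (intro powr_mono2) (auto simp: X0_norm_def)
    then have "G u \<le> B' powr p" using X0_norm_powr[OF u(1)] by simp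
    then have "u x \<le> c * B'" for x
      using cb[OF u(1) \<open>B' > 0\<close>, of x] abs_ge_self[of "u x"] by linarith
    then have "lam * Psi u \<le> lam * (A * F (c * B'))" using Psi_le[OF u(1)] lam by simp
    moreover have "G u / p \<ge> 0" using p_gt_1 by simp
    ultimately have "E u > - l" by (simp add: E_def l_def)
    then show False using u(4) E\<tau> by (simp add: v_def)
  qed
  with u show ?thesis by blast
qed

text \<open>The order of choice is opposite to that for large norms: \<open>t\<close> fixes a small
  ball first, then \<tau> is taken so small that \<open>\<tau> * w\<close> fits into it, with
  negative energy. As the zero function has energy 0, it is not the minimiser.\<close>

lemma small_solution_exists:
  assumes liminf: "\<And>e. e > 0 \<Longrightarrow> \<exists>\<^sub>F t in at_right 0. F t / t powr p < e"
    and limsup: "\<And>K. \<exists>\<^sub>F t in at_right 0. F t / t powr p > K" and d: "d > 0"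
  shows "\<exists>u\<in>W. weak_solution s p \<Omega> \<alpha> f lam u \<and> (\<forall>x. u x \<ge> 0) \<and>
     0 < X0_norm s p u \<and> X0_norm s p u < d \<and> (\<forall>x. u x \<le> d)"
proof -
  obtain c where c: "c > 0"
    and cb: "\<And>u h x. u \<in> W \<Longrightarrow> h > 0 \<Longrightarrow> G u \<le> h powr p \<Longrightarrow> \<bar>u x\<bar> \<le> c * h"
    and sol: "\<And>t. t > 0 \<Longrightarrow> p * lam * A * F t < (t / c) powr p \<Longrightarrow>
      \<exists>u\<in>W. weak_solution s p \<Omega> \<alpha> f lam u \<and> (\<forall>x. 0 \<le> u x) \<and> (\<forall>x. u x \<le> t) \<and> G u \<le> (t / c) powr p \<and>
        (\<forall>v\<in>W. G v \<le> (t / c) powr p \<longrightarrow> E u \<le> E v)"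
    by (rule solutions_exist) blast
  obtain e where e: "e > 0" "\<And>t. t > 0 \<Longrightarrow> F t / t powr p < e \<Longrightarrow> p * lam * A * F t < (t / c) powr p"
    using small_quotient[OF c] by metis
  obtain w g b where w: "w \<in> W" "G w = g" "b > 0" "\<And>t. t \<ge> 0 \<Longrightarrow> E (\<lambda>x. t * w x) \<le> t powr p * g / p - b * F t"
    using bump_energy by metis
  \<comment> \<open>\<open>t < d\<close> controls the values of the solution,
    \<open>t < c * d\<close> its norm, which is at most \<open>t / c\<close>.\<close>
  have "\<forall>\<^sub>F t in at_right 0. t > 0 \<and> t < min d (c * d)"
    using c d eventually_at_right_real[of 0 "min d (c * d)"] by auto
  with liminf[OF e(1)] have "\<exists>\<^sub>F t in at_right 0. F t / t powr p < e \<and> (t > 0 \<and> t < min d (c * d))"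
    by (rule frequently_eventually_frequently)
  then obtain t where t: "F t / t powr p < e" "t > 0" "t < d" "t < c * d" by (auto dest: frequently_ex)
  have "((\<lambda>\<tau>. \<tau> powr p * g) \<longlongrightarrow> 0 powr p * g) (at_right 0)"
    using p_gt_1 by (intro tendsto_intros tendsto_powr') (auto simp: eventually_at_right_less eventually_at_filter)
  then have "\<forall>\<^sub>F \<tau> in at_right 0. \<tau> powr p * g < (t / c) powr p"
    using t c by (intro order_tendstoD(2)[where y = "0 powr p * g"]) auto
  then have "\<forall>\<^sub>F \<tau> in at_right 0. \<tau> powr p * g < (t / c) powr p \<and> \<tau> > 0"
    by (intro eventually_conj eventually_at_right_less)
  with limsup have "\<exists>\<^sub>F \<tau> in at_right 0. F \<tau> / \<tau> powr p > g / p / b \<and> (\<tau> powr p * g < (t / c) powr p \<and> \<tau> > 0)"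
    by (rule frequently_eventually_frequently)
  then obtain \<tau> where \<tau>: "F \<tau> / \<tau> powr p > g / p / b" "\<tau> powr p * g < (t / c) powr p" "\<tau> > 0"
    by (auto dest: frequently_ex)
  define v where "v = (\<lambda>x. \<tau> * w x)"
  have v: "v \<in> W" "G v < (t / c) powr p" unfolding v_def using W_scaled[OF w(1), of \<tau>] w(2) \<tau> by auto
  have "g / p < F \<tau> / \<tau> powr p * b" using \<tau>(1) w(3) by (simp only: pos_divide_less_eq)
  then have "\<tau> powr p * (g / p) < \<tau> powr p * (F \<tau> / \<tau> powr p * b)"
    using \<tau>(3) by (intro mult_strict_left_mono) auto
  then have "\<tau> powr p * (g / p) < b * F \<tau>" using \<tau>(3) by (simp add: mult.commute)
  then have Ev: "E v < 0" using w(4)[of \<tau>] \<tau> by (simp add: v_def)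
  obtain u where u: "u \<in> W" "weak_solution s p \<Omega> \<alpha> f lam u" "\<forall>x. 0 \<le> u x" "E u \<le> E v"
      "\<forall>x. u x \<le> t" "G u \<le> (t / c) powr p"
    using sol[OF t(2) e(2)[OF t(2) t(1)]] v by (meson less_imp_le)
  have "G u \<noteq> 0"
  proof
    assume "G u = 0"
    then have "u = (\<lambda>_. 0)" by (rule G_zero_imp_zero[OF u(1) _ _ c]) (rule cb)
    then show False using u(4) Ev E_zero by simp
  qed
  then have "0 < X0_norm s p u" using u(1) by (simp add: X0_norm_W)
  moreover have "X0_norm s p u \<le> t / c"
  proof -
    have "G u powr (1 / p) \<le> ((t / c) powr p) powr (1 / p)" using u(6) p_gt_1 by (intro powr_mono2) auto
    also have "\<dots> = t / c" using t c p_gt_1 by (simp add: powr_powr)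
    finally show ?thesis by (simp add: X0_norm_W u)
  qed
  moreover have "t / c < d" using t c by (simp add: field_simps)
  moreover have "\<forall>x. u x \<le> d" using u(5) t(3) by (meson less_imp_le order_trans)
  ultimately show ?thesis using u by (intro bexI[of _ u]) auto
qed

end

text \<open>Choosing each member independently could repeat values of \<open>N\<close>; each choice
  is therefore forced above its predecessor.\<close>

lemma strictly_increasing_choice:
  fixes N :: "'b \<Rightarrow> real"
  assumes ex: "\<And>B. \<exists>x. P x \<and> B \<le> N x"
  obtains u :: "nat \<Rightarrow> 'b" where "\<And>j. P (u j)" "\<And>i j. i \<noteq> j \<Longrightarrow> N (u i) \<noteq> N (u j)"
    "filterlim (\<lambda>j. N (u j)) at_top sequentially"
proof -
  have "\<exists>u. \<forall>n. (P (u n) \<and> real n \<le> N (u n)) \<and> N (u n) < N (u (Suc n))"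
  proof (rule dependent_nat_choice)
    show "\<exists>x. P x \<and> real 0 \<le> N x" using ex[of 0] by simp
    fix x n
    show "\<exists>y. (P y \<and> real (Suc n) \<le> N y) \<and> N x < N y"
      using ex[of "max (real (Suc n)) (N x + 1)"] by force
  qed
  then obtain u where u: "\<And>n. P (u n)" "\<And>n. real n \<le> N (u n)" "\<And>n. N (u n) < N (u (Suc n))" by blast
  have "strict_mono (\<lambda>n. N (u n))" using u(3) by (simp add: strict_mono_Suc_iff)
  then have "N (u i) \<noteq> N (u j)" if "i \<noteq> j" for i j
    using that strict_mono_eq[of "\<lambda>n. N (u n)" i j] by simp
  moreover have "filterlim (\<lambda>j. N (u j)) at_top sequentially"
    by (rule filterlim_at_top_mono[OF filterlim_real_sequentially always_eventually]) (use u(2) in blast)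
  ultimately show ?thesis using that u(1) by blast
qed

text \<open>\<open>0 < N x\<close> drives the recursion: the minimum of \<open>N\<close> at the
  current member and the next reciprocal serves as the next \<open>d\<close>. For solutions, this is
  where the minimiser being nonzero is used.\<close>

lemma strictly_decreasing_choice:
  fixes N T :: "'b \<Rightarrow> real"
  assumes ex: "\<And>d. d > 0 \<Longrightarrow> \<exists>x. P x \<and> 0 < N x \<and> N x < d \<and> 0 \<le> T x \<and> T x \<le> d"
  obtains u :: "nat \<Rightarrow> 'b" where "\<And>j. P (u j)" "\<And>i j. i \<noteq> j \<Longrightarrow> N (u i) \<noteq> N (u j)"
    "(\<lambda>j. N (u j)) \<longlonglongrightarrow> 0" "(\<lambda>j. T (u j)) \<longlonglongrightarrow> 0"
proof -
  define Q where "Q n x \<longleftrightarrow> P x \<and> 0 < N x \<and> N x \<le> inverse (real (Suc n)) \<and>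
      0 \<le> T x \<and> T x \<le> inverse (real (Suc n))" for n x
  have "\<exists>u. \<forall>n. Q n (u n) \<and> N (u (Suc n)) < N (u n)"
  proof (rule dependent_nat_choice)
    show "\<exists>x. Q 0 x" using ex[of 1] by (force simp: Q_def)
    fix x n assume "Q n x"
    then have "min (inverse (real (Suc (Suc n)))) (N x) > 0" by (simp add: Q_def)
    from ex[OF this] show "\<exists>y. Q (Suc n) y \<and> N y < N x" by (force simp: Q_def)
  qed
  then obtain u where u: "\<And>n. Q n (u n)" "\<And>n. N (u (Suc n)) < N (u n)" by blast
  have "strict_mono (\<lambda>n. - N (u n))" using u(2) by (simp add: strict_mono_Suc_iff)
  then have ne: "N (u i) \<noteq> N (u j)" if "i \<noteq> j" for i j
    using that strict_mono_eq[of "\<lambda>n. - N (u n)" i j] by simp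
  have "(\<lambda>j. N (u j)) \<longlonglongrightarrow> 0" "(\<lambda>j. T (u j)) \<longlonglongrightarrow> 0"
    by (rule tendsto_sandwich[OF _ _ tendsto_const LIMSEQ_inverse_real_of_nat];
        use u(1) in \<open>auto simp: Q_def less_imp_le intro!: always_eventually\<close>)+
  then show ?thesis using that[of u] u(1) ne by (auto simp: Q_def)
qed

theorem corollary1p2:
  fixes \<Omega> :: "'a::euclidean_space set"
    and s p :: real
    and \<alpha> :: "'a \<Rightarrow> real"
    and f :: "real \<Rightarrow> real"
    and L :: "real filter"
  assumes "bounded_lipschitz_domain \<Omega>"
    and "0 < s" and "s < 1" and "p > real DIM('a) / s"
    and "\<alpha> \<in> L_infty (lebesgue_on \<Omega>)" and "essinf (lebesgue_on \<Omega>) \<alpha> > 0"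
    and "continuous_on UNIV f" and "\<And>t. f t \<ge> 0" and "f 0 = 0"
    and "L \<in> {at_right 0, at_top}"
    and "Liminf L (\<lambda>t. ereal (primitive f t / t powr p)) = 0"
    and "Limsup L (\<lambda>t. ereal (primitive f t / t powr p)) = \<infinity>"
  shows "\<forall>lam>0. \<exists>u :: nat \<Rightarrow> 'a \<Rightarrow> real.
           (\<forall>j. weak_solution s p \<Omega> \<alpha> f lam (u j) \<and> (\<forall>x. u j x \<ge> 0) \<and>
                continuous_on (closure \<Omega>) (u j)) \<and>
           (\<forall>i j. i \<noteq> j \<longrightarrow> \<not> (AE x in lebesgue. u i x = u j x)) \<and>
           (L = at_top \<longrightarrow> filterlim (\<lambda>j. X0_norm s p (u j)) at_top sequentially) \<and>
           (L = at_right 0 \<longrightarrow>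
              (\<lambda>j. X0_norm s p (u j)) \<longlonglongrightarrow> 0 \<and> (\<lambda>j. sup_norm \<Omega> (u j)) \<longlonglongrightarrow> 0)"
proof (intro allI impI)
  fix lam :: real assume lam: "lam > 0"
  have dom: "open \<Omega>" "\<Omega> \<noteq> {}" "bounded \<Omega>" using assms(1) by (auto simp: bounded_lipschitz_domain_def)
  obtain c where c: "0 < c" "AE x in lebesgue_on \<Omega>. c \<le> ereal (\<alpha> x)"
    using assms(6) unfolding essinf_def less_Sup_iff by auto
  obtain m where m: "m > 0" "AE x in lebesgue_on \<Omega>. m \<le> \<alpha> x"
  proof -
    \<comment> \<open>\<open>c\<close> is an extended real; a real constant between 0 and
      \<open>c\<close> is needed.\<close>
    obtain m where m: "0 < ereal m" "ereal m < c" using ereal_dense2[OF c(1)] by auto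
    have "AE x in lebesgue_on \<Omega>. m \<le> \<alpha> x"
      using c(2)
    proof eventually_elim
      case (elim x)
      then have "ereal m \<le> ereal (\<alpha> x)" using m(2) by (meson less_imp_le order_trans)
      then show ?case by simp
    qed
    with m(1) show ?thesis by (intro that[of m]) auto
  qed
  obtain M where M: "AE x in lebesgue_on \<Omega>. \<alpha> x \<le> M"
  proof -
    have "esssup (lebesgue_on \<Omega>) (\<lambda>x. ereal \<bar>\<alpha> x\<bar>) < \<infinity>" using assms(5) by (simp add: L_infty_def)
    then obtain M where M: "esssup (lebesgue_on \<Omega>) (\<lambda>x. ereal \<bar>\<alpha> x\<bar>) < ereal M"
      using less_PInf_Ex_of_nat[of "esssup (lebesgue_on \<Omega>) (\<lambda>x. ereal \<bar>\<alpha> x\<bar>)"] by auto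
    have "AE x in lebesgue_on \<Omega>. \<alpha> x \<le> M"
      using esssup_AE[of "\<lambda>x. ereal \<bar>\<alpha> x\<bar>" "lebesgue_on \<Omega>"]
    proof eventually_elim
      case (elim x)
      then have "ereal \<bar>\<alpha> x\<bar> < ereal M" using M by (meson le_less_trans)
      then show ?case by simp
    qed
    then show ?thesis by (rule that)
  qed
  have ps: "p * s > real DIM('a)" using assms(2,4) by (simp add: field_simps)
  interpret frac_problem \<Omega> s p \<alpha> f lam m M
    using dom assms lam m M ps by unfold_locales (auto simp: L_infty_def)
  \<comment> \<open>In the form of frequently true statements, the conditions can be combined with
    side conditions on \<open>t\<close> that hold eventually.\<close>
  have liminf: "\<exists>\<^sub>F t in L. F t / t powr p < e" if "e > 0" for e :: real
  proof (rule ccontr)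
    assume "\<not> (\<exists>\<^sub>F t in L. F t / t powr p < e)"
    then have "\<forall>\<^sub>F t in L. ereal e \<le> ereal (F t / t powr p)"
      by (simp add: not_frequently not_less)
    then have "ereal e \<le> 0" using Liminf_bounded assms(11) by metis
    then show False using that by simp
  qed
  have limsup: "\<exists>\<^sub>F t in L. F t / t powr p > K" for K :: real
  proof (rule ccontr)
    assume "\<not> (\<exists>\<^sub>F t in L. F t / t powr p > K)"
    then have "\<forall>\<^sub>F t in L. ereal (F t / t powr p) \<le> ereal K"
      by (simp add: not_frequently not_less)
    then have "\<infinity> \<le> ereal K" using Limsup_bounded assms(12) by metis
    then show False by simp
  qed
  let ?P = "\<lambda>u. u \<in> W \<and> weak_solution s p \<Omega> \<alpha> f lam u \<and> (\<forall>x. u x \<ge> 0)"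
  have cont: "continuous_on (closure \<Omega>) u" if "u \<in> W" for u
    using that continuous_on_subset by (auto simp: W_def)
  \<comment> \<open>The conclusion has one implication for each value of \<open>L\<close>; as the
    two filters differ, the other implication is vacuous in each case.\<close>
  have ne: "(at_top :: real filter) \<noteq> at_right 0"
  proof
    assume eq: "(at_top :: real filter) = at_right 0"
    have "\<forall>\<^sub>F t :: real in at_top. t \<in> {0<..<1}"
      unfolding eq by (rule eventually_at_right_real) simp
    with eventually_gt_at_top[of "1::real"] have "\<forall>\<^sub>F t :: real in at_top. False"
      by eventually_elim auto
    then show False by simp
  qed
  from assms(10) consider "L = at_right 0" | "L = at_top" by auto
  then show "\<exists>u :: nat \<Rightarrow> 'a \<Rightarrow> real.
           (\<forall>j. weak_solution s p \<Omega> \<alpha> f lam (u j) \<and> (\<forall>x. u j x \<ge> 0) \<and>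
                continuous_on (closure \<Omega>) (u j)) \<and>
           (\<forall>i j. i \<noteq> j \<longrightarrow> \<not> (AE x in lebesgue. u i x = u j x)) \<and>
           (L = at_top \<longrightarrow> filterlim (\<lambda>j. X0_norm s p (u j)) at_top sequentially) \<and>
           (L = at_right 0 \<longrightarrow>
              (\<lambda>j. X0_norm s p (u j)) \<longlonglongrightarrow> 0 \<and> (\<lambda>j. sup_norm \<Omega> (u j)) \<longlonglongrightarrow> 0)"
  proof cases
    case 1
    have "\<exists>u. ?P u \<and> 0 < X0_norm s p u \<and> X0_norm s p u < d \<and> 0 \<le> sup_norm \<Omega> u \<and> sup_norm \<Omega> u \<le> d"
      if d: "d > 0" for d
    proof -
      obtain u where u: "?P u" "0 < X0_norm s p u" "X0_norm s p u < d" "\<forall>x. u x \<le> d"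
        using small_solution_exists[OF liminf[unfolded 1] limsup[unfolded 1] d] by blast
      have a: "\<bar>u x\<bar> \<le> d" for x using u(1,4) by simp
      obtain x0 where x0: "x0 \<in> closure \<Omega>" using dom closure_subset by blast
      have "sup_norm \<Omega> u \<le> d" unfolding sup_norm_def using x0 a by (intro cSUP_least) auto
      moreover have "\<bar>u x0\<bar> \<le> sup_norm \<Omega> u"
        unfolding sup_norm_def using x0 a by (intro cSUP_upper) (auto intro!: bdd_aboveI)
      moreover from this have "0 \<le> sup_norm \<Omega> u" using abs_ge_zero[of "u x0"] by linarith
      ultimately show ?thesis using u by (intro exI[of _ u]) auto
    qed
    then obtain u :: "nat \<Rightarrow> 'a \<Rightarrow> real" where u: "\<And>j. ?P (u j)"
      "\<And>i j. i \<noteq> j \<Longrightarrow> X0_norm s p (u i) \<noteq> X0_norm s p (u j)"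
      "(\<lambda>j. X0_norm s p (u j)) \<longlonglongrightarrow> 0" "(\<lambda>j. sup_norm \<Omega> (u j)) \<longlonglongrightarrow> 0"
      using strictly_decreasing_choice[of ?P "X0_norm s p" "sup_norm \<Omega>"] by metis
    have "\<not> (AE x in lebesgue. u i x = u j x)" if "i \<noteq> j" for i j
      using u(1)[of i] u(1)[of j] u(2)[OF that] W_AE_eq[of "u i" "u j"] by auto
    then show ?thesis using u cont ne 1 by (intro exI[of _ u]) auto
  next
    case 2
    have "\<exists>u. ?P u \<and> B \<le> X0_norm s p u" for B
      using large_solution_exists[OF liminf[unfolded 2] limsup[unfolded 2], of B] by blast
    then obtain u :: "nat \<Rightarrow> 'a \<Rightarrow> real" where u: "\<And>j. ?P (u j)"
      "\<And>i j. i \<noteq> j \<Longrightarrow> X0_norm s p (u i) \<noteq> X0_norm s p (u j)"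
      "filterlim (\<lambda>j. X0_norm s p (u j)) at_top sequentially"
      using strictly_increasing_choice[of ?P "X0_norm s p"] by metis
    have "\<not> (AE x in lebesgue. u i x = u j x)" if "i \<noteq> j" for i j
      using u(1)[of i] u(1)[of j] u(2)[OF that] W_AE_eq[of "u i" "u j"] by auto
    then show ?thesis using u cont ne 2 by (intro exI[of _ u]) auto
  qed
qed

end
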